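(* Let $A$ be a complex analytic set in $\mathbb C^n$. For every $p\in A$ there exist an open neighborhood $V$ of $p$ and a continuous function $u\in W^{1,2}_{loc}(V)$ such that the set of removable singularity of $\nabla u$ is $A\cap V$; that is, $u$ is (real) differentiable in the classical sense at every point of $V\setminus A$, fails to be differentiable in the classical sense at every point of $A\cap V$, and the weak gradient of $u$ exists on all of $V$ and belongs to $L^2_{loc}(V)$.
   Context: $\mathbb C^n$ is identified with $\mathbb R^{2n}$. A complex analytic set $A$ in $\mathbb C^n$ is a set such that each $p\in A$ has a connected open neighborhood $V$ in which $A\cap V$ is the common zero set of finitely many holomorphic functions on $V$, not all identically zero. $W^{1,2}_{loc}(V)$ is the space of functions on $V$ in $L^2_{loc}(V)$ whose first-order weak derivatives exist on $V$ and belong to $L^2_{loc}(V)$. A removable singularity of $\nabla u$ means a point at which $\nabla u$ is singular in the classical sense ($u$ is not classically differentiable there), while the weak gradient exists across that point as a locally integrable function. *)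

theory Defs
  imports "HOL-Analysis.Analysis"
begin

text \<open>
  Complex \<open>n\<close>-space is the type \<open>complex ^ 'n\<close>. As a \<open>euclidean_space\<close> over the reals it has
  the \<open>2n\<close> basis vectors \<open>axis i 1\<close> and \<open>axis i \<i>\<close>, so \<open>lebesgue\<close>, \<open>differentiable\<close> and
  \<open>frechet_derivative\<close> on it are those of real \<open>2n\<close>-space.
\<close>

text \<open>Holomorphy in several variables: total differentiability with complex linear derivative.\<close>

definition holomorphic_several ::
    "(complex ^ 'n \<Rightarrow> complex) \<Rightarrow> (complex ^ 'n) set \<Rightarrow> bool" where
  "holomorphic_several f V \<longleftrightarrow>
     (\<forall>z\<in>V. \<exists>D. (f has_derivative D) (at z) \<and> (\<forall>c v. D (c *s v) = c * D v))"

text \<open>``Not all identically zero'' means that some function of the family is not identically zero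
  on \<open>V\<close>; in particular the family is nonempty.\<close>

definition complex_analytic_set :: "(complex ^ 'n) set \<Rightarrow> bool" where
  "complex_analytic_set A \<longleftrightarrow>
     (\<forall>p\<in>A. \<exists>V. open V \<and> connected V \<and> p \<in> V \<and>
        (\<exists>F. finite F \<and> (\<forall>f\<in>F. holomorphic_several f V) \<and>
             (\<exists>f\<in>F. \<exists>z\<in>V. f z \<noteq> 0) \<and>
             A \<inter> V = {z \<in> V. \<forall>f\<in>F. f z = 0}))"

primrec C_k :: "nat \<Rightarrow> ('a::euclidean_space \<Rightarrow> real) \<Rightarrow> bool" where
  "C_k 0 f \<longleftrightarrow> continuous_on UNIV f"
| "C_k (Suc k) f \<longleftrightarrow>
     (\<forall>x. f differentiable (at x)) \<and>
     (\<forall>b\<in>Basis. C_k k (\<lambda>x. frechet_derivative f (at x) b))"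

definition test_function :: "'a::euclidean_space set \<Rightarrow> ('a \<Rightarrow> real) \<Rightarrow> bool" where
  "test_function V \<phi> \<longleftrightarrow>
     (\<forall>k. C_k k \<phi>) \<and> compact (closure {x. \<phi> x \<noteq> 0}) \<and> closure {x. \<phi> x \<noteq> 0} \<subseteq> V"

text \<open>Functions on an open set \<open>V\<close> are total functions of which only the values on \<open>V\<close> matter.\<close>

definition L1_loc ::
    "'a::euclidean_space set \<Rightarrow> ('a \<Rightarrow> 'b::euclidean_space) \<Rightarrow> bool" where
  "L1_loc V f \<longleftrightarrow>
     set_borel_measurable lebesgue V f \<and>
     (\<forall>K. compact K \<and> K \<subseteq> V \<longrightarrow> set_integrable lebesgue K f)"

definition L2_loc ::
    "'a::euclidean_space set \<Rightarrow> ('a \<Rightarrow> 'b::euclidean_space) \<Rightarrow> bool" where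
  "L2_loc V f \<longleftrightarrow>
     set_borel_measurable lebesgue V f \<and>
     (\<forall>K. compact K \<and> K \<subseteq> V \<longrightarrow> set_integrable lebesgue K (\<lambda>x. (norm (f x))\<^sup>2))"

text \<open>\<open>G x \<bullet> b\<close> is the weak partial derivative of \<open>u\<close> in the coordinate direction \<open>b\<close>.\<close>

definition has_weak_gradient ::
    "('a::euclidean_space \<Rightarrow> real) \<Rightarrow> ('a \<Rightarrow> 'a) \<Rightarrow> 'a set \<Rightarrow> bool" where
  "has_weak_gradient u G V \<longleftrightarrow>
     L1_loc V u \<and> L1_loc V G \<and>
     (\<forall>\<phi>. test_function V \<phi> \<longrightarrow>
        (\<forall>b\<in>Basis.
           set_lebesgue_integral lebesgue V (\<lambda>x. u x * frechet_derivative \<phi> (at x) b) =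
           - set_lebesgue_integral lebesgue V (\<lambda>x. (G x \<bullet> b) * \<phi> x)))"

definition W12_loc :: "'a::euclidean_space set \<Rightarrow> ('a \<Rightarrow> real) \<Rightarrow> bool" where
  "W12_loc V u \<longleftrightarrow> L2_loc V u \<and> (\<exists>G. has_weak_gradient u G V \<and> L2_loc V G)"

text \<open>Points of \<open>V\<close> where \<open>u\<close> is not classically differentiable although the weak gradient exists,
  as a locally integrable function, on a full neighbourhood of the point.\<close>

definition removable_gradient_singularities ::
    "'a::euclidean_space set \<Rightarrow> ('a \<Rightarrow> real) \<Rightarrow> 'a set" where
  "removable_gradient_singularities V u =
     {x \<in> V. \<not> u differentiable (at x) \<and>
        (\<exists>U G. open U \<and> x \<in> U \<and> U \<subseteq> V \<and> has_weak_gradient u G U)}"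

end

theory Submission
  imports Defs "HOL-Complex_Analysis.Complex_Analysis" "HOL-Real_Asymp.Real_Asymp"
begin

text \<open>
  Near \<open>p\<close> let \<open>A\<close> be the zero set of \<open>h = \<Sum>\<bar>f\<bar>\<^sup>2\<close> and take \<open>u = - 1 / ln h\<close>, with \<open>u = 0\<close> on \<open>A\<close>.
  Since \<open>ln h\<close> is plurisubharmonic and \<open>s \<mapsto> - 1 / s\<close> is convex and increasing for \<open>s < 0\<close>, the
  function \<open>u\<close> is bounded, nonnegative and subharmonic, so the Caccioppoli inequality gives it a
  locally square integrable gradient. To avoid distributional Laplacians this is done for
  \<open>- 1 / ln (h + \<epsilon>)\<close> with bounds uniform in \<open>\<epsilon>\<close>; these regularisations have gradients dominated by
  the pointwise gradient of \<open>u\<close> and converging to it, which yields the weak derivative. On a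
  complex line through a point of \<open>A\<close> on which some \<open>f\<close> does not vanish identically, \<open>h\<close> decays only
  like a power of the distance, so \<open>u\<close> decays only like \<open>1 / \<bar>ln t\<bar>\<close> and is not differentiable.
\<close>

section \<open>Directional derivatives and integration by parts\<close>

text \<open>No fixed power of \<open>h\<close> would do: it becomes differentiable where the
  functions vanish to high order, and that order may change from point to point. For the logarithm
  the order only enters through a constant factor. The inequality behind the energy bound is used in
  one complex coordinate at a time. For the two real directions of that coordinate, the squares of
  the first derivatives of \<open>h\<close> add up to at most \<open>h\<close> times the sum of the
  pure second derivatives. This says that the Laplacian of \<open>ln h\<close> in that plane is
  nonnegative, multiplied by \<open>h\<^sup>2\<close>, and in this form it makes sense at zeros of
  \<open>h\<close> too. It involves only derivatives along single lines, which one-variable complex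
  analysis supplies together with Cauchy bounds; hence the calculus of directional
  derivatives.\<close>

definition has_dir_derivative ::
    "('a::real_normed_vector \<Rightarrow> real) \<Rightarrow> 'a \<Rightarrow> 'a \<Rightarrow> real \<Rightarrow> bool" where
  "has_dir_derivative g b x d \<longleftrightarrow> ((\<lambda>t. g (x + t *\<^sub>R b)) has_real_derivative d) (at 0)"

lemma has_dir_derivative_const: "has_dir_derivative (\<lambda>x. c) b x 0"
  unfolding has_dir_derivative_def by simp

lemma has_dir_derivative_add:
  assumes "has_dir_derivative f b x d" "has_dir_derivative g b x e"
  shows "has_dir_derivative (\<lambda>x. f x + g x) b x (d + e)"
  using assms unfolding has_dir_derivative_def by (rule DERIV_add)

lemma has_dir_derivative_diff:
  assumes "has_dir_derivative f b x d" "has_dir_derivative g b x e"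
  shows "has_dir_derivative (\<lambda>x. f x - g x) b x (d - e)"
  using assms unfolding has_dir_derivative_def by (rule DERIV_diff)

lemma has_dir_derivative_mult:
  assumes "has_dir_derivative f b x d" "has_dir_derivative g b x e"
  shows "has_dir_derivative (\<lambda>x. f x * g x) b x (d * g x + f x * e)"
  using DERIV_mult[OF assms[unfolded has_dir_derivative_def]]
  unfolding has_dir_derivative_def by (simp add: algebra_simps)

lemma has_dir_derivative_sum:
  assumes "\<And>i. i \<in> I \<Longrightarrow> has_dir_derivative (f i) b x (d i)"
  shows "has_dir_derivative (\<lambda>x. \<Sum>i\<in>I. f i x) b x (\<Sum>i\<in>I. d i)"
  using assms unfolding has_dir_derivative_def by (intro DERIV_sum) auto

lemma has_dir_derivative_compose:
  assumes "has_dir_derivative g b x d" "(\<Phi> has_real_derivative D) (at (g x))"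
  shows "has_dir_derivative (\<lambda>x. \<Phi> (g x)) b x (D * d)"
  using DERIV_chain2[of \<Phi> D "\<lambda>t. g (x + t *\<^sub>R b)" 0 d UNIV] assms
  unfolding has_dir_derivative_def by simp

lemma has_dir_derivative_at_iff:
  "has_dir_derivative g b (x + s *\<^sub>R b) d \<longleftrightarrow>
     ((\<lambda>t. g (x + t *\<^sub>R b)) has_real_derivative d) (at s)"
  using DERIV_shift[of "\<lambda>t. g (x + t *\<^sub>R b)" d 0 s]
  unfolding has_dir_derivative_def by (simp add: algebra_simps)

lemma has_derivative_imp_has_dir_derivative:
  assumes "(f has_derivative D) (at x)"
  shows "has_dir_derivative f b x (D b)"
proof -
  have "((\<lambda>t. x + t *\<^sub>R b) has_derivative (\<lambda>t. t *\<^sub>R b)) (at 0)"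
    by (auto intro!: derivative_eq_intros)
  then have "((\<lambda>t. f (x + t *\<^sub>R b)) has_derivative (\<lambda>t. D (t *\<^sub>R b))) (at 0)"
    using diff_chain_at[of "\<lambda>t. x + t *\<^sub>R b" "\<lambda>t. t *\<^sub>R b" 0 f D] assms by (simp add: o_def)
  moreover have "D (t *\<^sub>R b) = D b * t" for t
    using linear_scale[OF has_derivative_linear[OF assms]] by simp
  ultimately show ?thesis
    unfolding has_dir_derivative_def has_field_derivative_def by (simp add: mult_commute_abs)
qed

lemma eventually_at_line:
  fixes x b :: "'a::real_normed_vector"
  assumes "open W" "x \<in> W"
  shows "\<forall>\<^sub>F t in nhds (0::real). x + t *\<^sub>R b \<in> W"
proof -
  have "((\<lambda>t. x + t *\<^sub>R b) \<longlongrightarrow> x + 0 *\<^sub>R b) (nhds 0)"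
    by (intro tendsto_intros filterlim_ident)
  then show ?thesis
    using assms by (auto dest!: topological_tendstoD[where S=W])
qed

lemma has_dir_derivative_transform:
  assumes "has_dir_derivative f b x d" "open W" "x \<in> W" "\<And>y. y \<in> W \<Longrightarrow> f y = g y"
  shows "has_dir_derivative g b x d"
proof -
  have "\<forall>\<^sub>F t in nhds 0. f (x + t *\<^sub>R b) = g (x + t *\<^sub>R b)"
    using eventually_at_line[OF assms(2,3), of b] by eventually_elim (use assms(4) in auto)
  then show ?thesis
    using assms(1) unfolding has_dir_derivative_def by (subst (asm) DERIV_cong_ev) auto
qed

text \<open>The step sizes form a sequence so that limits of measurable functions and dominated
  convergence can be applied to the quotients.\<close>

lemma has_dir_derivative_tendsto_quotients:
  assumes "has_dir_derivative g b x d"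
  shows "(\<lambda>n. (g (x + (1 / Suc n) *\<^sub>R b) - g x) / (1 / Suc n)) \<longlonglongrightarrow> d"
proof -
  have "((\<lambda>t. (g (x + t *\<^sub>R b) - g x) / t) \<longlongrightarrow> d) (at 0)"
    using assms unfolding has_dir_derivative_def DERIV_def by simp
  moreover have "filterlim (\<lambda>n. 1 / real (Suc n)) (at 0) sequentially"
    using LIMSEQ_inverse_real_of_nat by (auto simp: filterlim_at inverse_eq_divide)
  ultimately show ?thesis
    by (rule filterlim_compose)
qed

text \<open>The derivative is a pointwise limit of difference quotients of the zero extension, so it
  is Borel even where its continuity is not known. Openness of \<open>W\<close> makes the extension
  agree with \<open>g\<close> near each point of \<open>W\<close>.\<close>

lemma borel_measurable_dir_derivative:
  fixes g :: "'a::euclidean_space \<Rightarrow> real"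
  assumes W: "open W" and g: "(\<lambda>x. indicator W x * g x) \<in> borel_measurable borel"
    and d: "\<And>x. x \<in> W \<Longrightarrow> has_dir_derivative g b x (g' x)"
  shows "(\<lambda>x. indicator W x * g' x) \<in> borel_measurable borel"
proof -
  define G where "G x = indicator W x * g x" for x
  have G[measurable]: "G \<in> borel_measurable borel"
    using g unfolding G_def .
  have W'[measurable]: "W \<in> sets borel" using W by simp
  show ?thesis
  proof (rule borel_measurable_LIMSEQ_real)
    fix x :: 'a
    show "(\<lambda>n. indicator W x * ((G (x + (1 / Suc n) *\<^sub>R b) - G x) / (1 / Suc n)))
            \<longlonglongrightarrow> indicator W x * g' x"
    proof (cases "x \<in> W")
      case True
      have "has_dir_derivative G b x (g' x)"
        by (rule has_dir_derivative_transform[OF d[OF True] W True]) (auto simp: G_def)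
      from has_dir_derivative_tendsto_quotients[OF this] show ?thesis
        using True by simp
    qed simp
  qed measurable
qed

section \<open>Integrals of directional derivatives\<close>

lemma integral_translation:
  fixes f :: "'a::euclidean_space \<Rightarrow> real"
  assumes "f \<in> borel_measurable borel"
  shows "(\<integral>x. f (x + c) \<partial>lborel) = (\<integral>x. f x \<partial>lborel)"
proof -
  have "(\<integral>x. f x \<partial>lborel) = (\<integral>x. f x \<partial>(distr lborel borel ((+) c)))"
    by (simp add: lborel_distr_plus)
  also have "\<dots> = (\<integral>x. f (c + x) \<partial>lborel)"
    using assms by (subst integral_distr) auto
  finally show ?thesis by (simp add: add.commute)
qed

lemma integrable_translation:
  fixes f :: "'a::euclidean_space \<Rightarrow> real"
  assumes "integrable lborel f"
  shows "integrable lborel (\<lambda>x. f (x + c))"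
proof -
  have "integrable (distr lborel borel ((+) c)) f"
    using assms by (simp add: lborel_distr_plus)
  then have "integrable lborel (\<lambda>x. f (c + x))"
    by (subst (asm) integrable_distr_eq) (use assms in auto)
  then show ?thesis by (simp add: add.commute)
qed

text \<open>By translation invariance the difference quotients of \<open>g\<close> have integral \<open>0\<close>, and they
  converge boundedly to \<open>g'\<close>.\<close>

lemma integral_dir_derivative_eq_0:
  fixes g :: "'a::euclidean_space \<Rightarrow> real"
  assumes g: "integrable lborel g"
    and d: "\<And>x. has_dir_derivative g b x (g' x)"
    and B: "\<And>x. \<bar>g' x\<bar> \<le> B"
    and K: "compact K" "\<And>x. x \<notin> K \<Longrightarrow> g x = 0"
  shows "integrable lborel g'" "(\<integral>x. g' x \<partial>lborel) = 0"
proof -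
  have gm[measurable]: "g \<in> borel_measurable borel" using g by auto
  obtain \<rho> where \<rho>: "\<And>x. x \<in> K \<Longrightarrow> norm x \<le> \<rho>"
    using compact_imp_bounded[OF K(1)] by (auto simp: bounded_iff)
  \<comment> \<open>Steps have length at most \<open>1\<close>, so all quotients vanish outside the
    ball of radius \<open>\<rho> + norm b\<close>; inside it the mean value theorem bounds them by
    \<open>B\<close>.\<close>
  define w where "w x = indicator (cball (0::'a) (\<rho> + norm b)) x * B" for x
  define s where "s n x = (g (x + (1 / real (Suc n)) *\<^sub>R b) - g x) / (1 / Suc n)" for n x
  have B0: "0 \<le> B" using B[of 0] by linarith
  have w: "integrable lborel w"
    unfolding w_def
    by (intro integrable_real_mult_indicator integrable_mult_left integrable_real_indicator)
      (use emeasure_bounded_finite[of "cball (0::'a) (\<rho> + norm b)"] in auto)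
  have lim: "(\<lambda>n. s n x) \<longlonglongrightarrow> g' x" for x
    unfolding s_def by (rule has_dir_derivative_tendsto_quotients[OF d])
  have sm: "s n \<in> borel_measurable lborel" for n
    unfolding s_def by measurable
  have bound: "norm (s n x) \<le> w x" for n x
  proof (cases "x \<in> cball 0 (\<rho> + norm b)")
    case False
    then have "norm x > \<rho> + norm b" by simp
    moreover have "norm ((1 / real (Suc n)) *\<^sub>R b) \<le> norm b"
      by (simp add: divide_le_eq algebra_simps)
    moreover have "norm x \<le> norm (x + (1 / real (Suc n)) *\<^sub>R b) + norm ((1 / real (Suc n)) *\<^sub>R b)"
      by (metis add_diff_cancel norm_triangle_ineq4)
    ultimately have "\<rho> < norm (x + (1 / real (Suc n)) *\<^sub>R b)" "\<rho> < norm x"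
      using norm_ge_zero[of b] by linarith+
    then have "x \<notin> K" "x + (1 / real (Suc n)) *\<^sub>R b \<notin> K"
      using \<rho> by force+
    then show ?thesis
      using False K(2) by (simp add: s_def w_def)
  next
    case True
    let ?h = "1 / real (Suc n)"
    have "\<exists>z::real. 0 < z \<and> z < ?h \<and>
        g (x + ?h *\<^sub>R b) - g (x + 0 *\<^sub>R b) = (?h - 0) * g' (x + z *\<^sub>R b)"
      using d by (intro MVT2) (auto simp: has_dir_derivative_at_iff[symmetric])
    then obtain z :: real where "g (x + ?h *\<^sub>R b) - g x = ?h * g' (x + z *\<^sub>R b)"
      by auto
    then have "s n x = g' (x + z *\<^sub>R b)" by (simp add: s_def)
    then show ?thesis using B True by (simp add: w_def)
  qed
  have s0: "(\<integral>x. s n x \<partial>lborel) = 0" for n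
  proof -
    have "(\<integral>x. g (x + (1 / real (Suc n)) *\<^sub>R b) - g x \<partial>lborel) = 0"
      using integral_translation[OF gm] integrable_translation[OF g] g
      by (subst Bochner_Integration.integral_diff) auto
    then show ?thesis
      unfolding s_def by simp
  qed
  have g'm: "g' \<in> borel_measurable lborel"
    by (rule borel_measurable_LIMSEQ_real[OF lim sm])
  show "integrable lborel g'"
    by (rule integrable_dominated_convergence[of g' lborel s w, OF g'm sm w]) (use lim bound in auto)
  have "(\<lambda>n. \<integral>x. s n x \<partial>lborel) \<longlonglongrightarrow> (\<integral>x. g' x \<partial>lborel)"
    by (rule integral_dominated_convergence[of g' lborel s w, OF g'm sm w]) (use lim bound in auto)
  then show "(\<integral>x. g' x \<partial>lborel) = 0"
    using s0 by (simp add: LIMSEQ_const_iff)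
qed

text \<open>The zero extension of \<open>g\<close> has a directional derivative everywhere: the open
  sets \<open>W\<close> and \<open>- K\<close> cover the space, and the extension vanishes on
  \<open>- K\<close>.\<close>

lemma integral_dir_derivative_eq_0_on:
  fixes g :: "'a::euclidean_space \<Rightarrow> real"
  assumes W: "open W" and K: "compact K" "K \<subseteq> W" "\<And>x. x \<in> W - K \<Longrightarrow> g x = 0"
    and g: "(\<lambda>x. indicator W x * g x) \<in> borel_measurable borel"
    and bg: "bounded (g ` W)"
    and d: "\<And>x. x \<in> W \<Longrightarrow> has_dir_derivative g b x (g' x)"
    and bg': "bounded (g' ` W)"
  shows "integrable lborel (\<lambda>x. indicator W x * g' x)"
    "(\<integral>x. indicator W x * g' x \<partial>lborel) = 0"
proof -
  obtain B0 where B0: "\<And>x. x \<in> W \<Longrightarrow> \<bar>g x\<bar> \<le> B0"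
    using bg by (auto simp: bounded_iff)
  obtain B where B: "\<And>x. x \<in> W \<Longrightarrow> \<bar>g' x\<bar> \<le> B"
    using bg' by (auto simp: bounded_iff)
  define G where "G x = indicator W x * g x" for x
  have G0: "G x = 0" if "x \<notin> K" for x
    using K(3) that by (auto simp: G_def indicator_def)
  have GK: "G x = indicator K x *\<^sub>R G x" for x
    using G0 by (auto simp: indicator_def)
  have iG: "integrable lborel G"
  proof (subst GK[abs_def], rule integrableI_bounded_set_indicator[where B=B0])
    show "emeasure lborel K < \<infinity>"
      by (rule emeasure_bounded_finite[OF compact_imp_bounded[OF K(1)]])
    show "AE x in lborel. x \<in> K \<longrightarrow> norm (G x) \<le> B0"
      using K(2) B0 by (intro AE_I2) (auto simp: G_def)
  qed (use g K(1) in \<open>simp_all add: G_def[abs_def] compact_imp_closed\<close>)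
  have dG: "has_dir_derivative G b x (indicator W x * g' x)" for x
  proof (cases "x \<in> W")
    case True
    then show ?thesis
      using has_dir_derivative_transform[OF d[OF True] W True, of G] by (simp add: G_def)
  next
    case False
    have "has_dir_derivative G b x 0"
      by (rule has_dir_derivative_transform[OF has_dir_derivative_const[of 0], of "- K"])
        (use K False G0 in \<open>auto simp: compact_imp_closed open_Compl\<close>)
    then show ?thesis using False by simp
  qed
  have bd: "\<bar>indicator W x * g' x\<bar> \<le> max B 0" for x
    using B[of x] by (auto simp: indicator_def)
  note * = integral_dir_derivative_eq_0[OF iG dG bd K(1) G0]
  show "integrable lborel (\<lambda>x. indicator W x * g' x)" by (rule *(1))
  show "(\<integral>x. indicator W x * g' x \<partial>lborel) = 0" by (rule *(2))
qed

section \<open>The reciprocal logarithm and cutoff functions\<close>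

text \<open>An exponent of at least \<open>2\<close> smooths the kink of \<open>max 0 y\<close>: at
  \<open>0\<close> the difference quotient is at most \<open>\<bar>t\<bar> ^ (n - 1)\<close>, which
  tends to \<open>0\<close>.\<close>

lemma max_power_has_real_derivative:
  fixes y :: real
  assumes n: "2 \<le> n"
  shows "((\<lambda>y. max 0 y ^ n) has_real_derivative real n * max 0 y ^ (n - 1)) (at y)"
proof -
  consider "y < 0" | "y > 0" | "y = 0" by linarith
  then show ?thesis
  proof cases
    case 1
    have "((\<lambda>y::real. 0) has_real_derivative real n * max 0 y ^ (n - 1)) (at y)"
      using 1 n by (simp add: max_absorb1 zero_power)
    then show ?thesis
      by (rule has_field_derivative_transform_within_open[where S="{..<0}"])
        (use 1 n in \<open>simp_all add: max_absorb1 zero_power\<close>)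
  next
    case 2
    have "((\<lambda>y. y ^ n) has_real_derivative real n * max 0 y ^ (n - 1)) (at y)"
      using 2 by (auto intro!: derivative_eq_intros)
    then show ?thesis
      by (rule has_field_derivative_transform_within_open[where S="{0<..}"]) (use 2 in auto)
  next
    case 3
    have "((\<lambda>t::real. \<bar>t\<bar> ^ (n - 1)) \<longlongrightarrow> \<bar>0\<bar> ^ (n - 1)) (at 0)"
      by (intro tendsto_intros)
    then have lim: "((\<lambda>t::real. \<bar>t\<bar> ^ (n - 1)) \<longlongrightarrow> 0) (at 0)"
      using n by (simp add: zero_power)
    have "norm (max 0 t ^ n / t) \<le> \<bar>t\<bar> ^ (n - 1)" for t :: real
      using n by (cases n) (auto simp: max_def power_abs)
    then have "((\<lambda>t::real. max 0 t ^ n / t) \<longlongrightarrow> 0) (at 0)"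
      by (intro Lim_null_comparison[OF always_eventually lim] allI)
    then show ?thesis
      using 3 n by (simp add: DERIV_def zero_power)
  qed
qed

text \<open>The cutoff is \<open>\<eta> x = max 0 (\<rho>\<^sup>2 - \<bar>x - p\<bar>\<^sup>2) ^ 3\<close>.\<close>

lemma cutoff_exists:
  fixes p :: "'a::euclidean_space"
  assumes "0 < r" "r < \<rho>"
  obtains \<eta> :: "'a \<Rightarrow> real" and \<eta>1 \<eta>2 :: "'a \<Rightarrow> 'a \<Rightarrow> real" and c :: real
  where "continuous_on UNIV \<eta>" "\<And>b. continuous_on UNIV (\<eta>1 b)" "\<And>b. continuous_on UNIV (\<eta>2 b)"
    "\<And>b x. has_dir_derivative \<eta> b x (\<eta>1 b x)" "\<And>b x. has_dir_derivative (\<eta>1 b) b x (\<eta>2 b x)"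
    "\<And>x. 0 \<le> \<eta> x" "0 < c" "\<And>x. x \<in> ball p r \<Longrightarrow> c \<le> \<eta> x"
    "\<And>x. x \<notin> cball p \<rho> \<Longrightarrow> \<eta> x = 0" "\<And>b x. x \<notin> cball p \<rho> \<Longrightarrow> \<eta>1 b x = 0"
proof
  define \<tau> where "\<tau> x = \<rho>\<^sup>2 - (x - p) \<bullet> (x - p)" for x
  \<comment> \<open>The cube leaves a factor \<open>max 0 (\<tau> x)\<close> in every term of the
    second derivative, so \<open>\<eta>2\<close> is continuous across the sphere of radius
    \<open>\<rho>\<close>.\<close>
  define \<eta> where "\<eta> x = max 0 (\<tau> x) ^ 3" for x
  define \<eta>1 where "\<eta>1 b x = 3 * max 0 (\<tau> x) ^ 2 * (- 2 * ((x - p) \<bullet> b))" for b x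
  define \<eta>2 where "\<eta>2 b x = 3 * (2 * max 0 (\<tau> x) * (- 2 * ((x - p) \<bullet> b))) * (- 2 * ((x - p) \<bullet> b))
     + 3 * max 0 (\<tau> x) ^ 2 * (- 2 * (b \<bullet> b))" for b x
  show "continuous_on UNIV \<eta>" "continuous_on UNIV (\<eta>1 b)" "continuous_on UNIV (\<eta>2 b)" for b
    unfolding \<eta>_def[abs_def] \<eta>1_def[abs_def] \<eta>2_def[abs_def] \<tau>_def by (intro continuous_intros)+
  have \<tau>': "has_dir_derivative \<tau> b x (- 2 * ((x - p) \<bullet> b))" for b x
  proof -
    have *: "\<tau> (x + t *\<^sub>R b) = \<tau> x - 2 * t * ((x - p) \<bullet> b) - t\<^sup>2 * (b \<bullet> b)" for t
      by (simp add: \<tau>_def inner_commute algebra_simps power2_eq_square)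
    show ?thesis
      unfolding has_dir_derivative_def * by (auto intro!: derivative_eq_intros)
  qed
  have l': "has_dir_derivative (\<lambda>x. - 2 * ((x - p) \<bullet> b)) b x (- 2 * (b \<bullet> b))" for b x
  proof -
    have *: "- 2 * ((x + t *\<^sub>R b - p) \<bullet> b) = - 2 * ((x - p) \<bullet> b) - 2 * t * (b \<bullet> b)" for t
      by (simp add: algebra_simps)
    show ?thesis
      unfolding has_dir_derivative_def * by (auto intro!: derivative_eq_intros)
  qed
  show "has_dir_derivative \<eta> b x (\<eta>1 b x)" for b x
    unfolding \<eta>_def[abs_def] \<eta>1_def
    using has_dir_derivative_compose[OF \<tau>' max_power_has_real_derivative[of 3]] by simp
  have m2: "has_dir_derivative (\<lambda>x. 3 * max 0 (\<tau> x) ^ 2) b x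
      (3 * (2 * max 0 (\<tau> x) * (- 2 * ((x - p) \<bullet> b))))" for b x
    using has_dir_derivative_mult[OF has_dir_derivative_const[of 3]
        has_dir_derivative_compose[OF \<tau>' max_power_has_real_derivative[of 2]]] by simp
  show "has_dir_derivative (\<eta>1 b) b x (\<eta>2 b x)" for b x
    unfolding \<eta>1_def[abs_def] \<eta>2_def by (rule has_dir_derivative_mult[OF m2 l'])
  show "0 \<le> \<eta> x" for x by (simp add: \<eta>_def)
  show "0 < (\<rho>\<^sup>2 - r\<^sup>2) ^ 3"
    using assms by (simp add: power_strict_mono)
  have nn: "(x - p) \<bullet> (x - p) = (dist p x)\<^sup>2" for x
    by (metis dist_norm norm_minus_commute power2_norm_eq_inner)
  show "(\<rho>\<^sup>2 - r\<^sup>2) ^ 3 \<le> \<eta> x" if "x \<in> ball p r" for x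
  proof -
    have "(dist p x)\<^sup>2 \<le> r\<^sup>2" using that by (intro power_mono) auto
    then have "\<rho>\<^sup>2 - r\<^sup>2 \<le> max 0 (\<tau> x)" by (simp add: \<tau>_def nn)
    moreover have "0 \<le> \<rho>\<^sup>2 - r\<^sup>2" using assms by (simp add: power_mono)
    ultimately show ?thesis unfolding \<eta>_def by (rule power_mono)
  qed
  have "max 0 (\<tau> x) = 0" if "x \<notin> cball p \<rho>" for x
  proof -
    have "\<rho>\<^sup>2 \<le> (dist p x)\<^sup>2" using that assms by (intro power_mono) auto
    then show ?thesis by (simp add: \<tau>_def nn)
  qed
  then show "\<eta> x = 0" "\<eta>1 b x = 0" if "x \<notin> cball p \<rho>" for b x
    using that by (simp_all add: \<eta>_def \<eta>1_def)
qed

text \<open>Since \<open>ln 0 = 0\<close> and \<open>1 / 0 = 0\<close>, this function takes the value \<open>0\<close> at \<open>0\<close>; it is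
  continuous and increasing on \<open>[0, 1)\<close>.\<close>

definition invlog :: "real \<Rightarrow> real" where
  "invlog s = - 1 / ln s"

definition invlog' :: "real \<Rightarrow> real" where
  "invlog' s = 1 / (s * (ln s)\<^sup>2)"

lemma invlog_0 [simp]: "invlog 0 = 0"
  by (simp add: invlog_def)

lemma ln_le_m2: "0 < (s::real) \<Longrightarrow> s \<le> exp (- 2) \<Longrightarrow> ln s \<le> - 2"
  using ln_mono[of s "exp (- 2)"] by simp

lemma invlog_bounds:
  assumes "0 \<le> s" "s \<le> exp (- 2)"
  shows "0 \<le> invlog s" "invlog s \<le> 1"
proof -
  have "0 \<le> invlog s \<and> invlog s \<le> 1"
  proof (cases "s = 0")
    case False
    define L where "L = - ln s"
    have "2 \<le> L" "invlog s = 1 / L"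
      using ln_le_m2[of s] assms False by (auto simp: L_def invlog_def)
    then show ?thesis by simp
  qed simp
  then show "0 \<le> invlog s" "invlog s \<le> 1" by auto
qed

lemma invlog_mono:
  assumes "0 < s" "s \<le> t" "t \<le> exp (- 2)"
  shows "invlog s \<le> invlog t"
proof -
  have "ln s \<le> ln t" "ln t \<le> - 2" using assms ln_le_m2[of t] by auto
  then have "1 / - ln s \<le> 1 / - ln t" by (intro divide_left_mono) (auto intro: mult_neg_neg)
  then show ?thesis by (simp add: invlog_def)
qed

lemma continuous_invlog: "continuous_on {0..exp (- 2)} invlog"
proof -
  have "continuous (at x within {0..exp (- 2)}) invlog" if x: "x \<in> {0..exp (- 2)}" for x
  proof (cases "x = 0")
    case True
    have "((\<lambda>s::real. - 1 / ln s) \<longlongrightarrow> 0) (at_right 0)"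
      by real_asymp
    moreover have "at x within {0..exp (- 2)} = at_right 0"
      using True by (simp add: at_within_Icc_at_right)
    ultimately show ?thesis
      using True by (simp add: continuous_within invlog_def[abs_def])
  next
    case False
    then have "ln x \<noteq> 0" using ln_le_m2[of x] x by auto
    then have "isCont (\<lambda>s. - 1 / ln s) x" using False x by (intro continuous_intros) auto
    then show ?thesis
      unfolding invlog_def[abs_def] by (rule continuous_at_imp_continuous_at_within)
  qed
  then show ?thesis by (simp add: continuous_on_eq_continuous_within)
qed

lemma invlog_has_derivative:
  assumes "0 < s" "s \<le> exp (- 2)"
  shows "(invlog has_real_derivative invlog' s) (at s)"
proof -
  have L: "ln s \<noteq> 0" using ln_le_m2[OF assms] by auto
  show ?thesis
    unfolding invlog_def[abs_def] invlog'_def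
    using DERIV_divide[OF DERIV_const[of "- 1"] DERIV_ln[OF assms(1)] L]
    by (simp add: power2_eq_square inverse_eq_divide)
qed

lemma invlog'_nonneg: "0 \<le> s \<Longrightarrow> 0 \<le> invlog' s"
  by (simp add: invlog'_def)

text \<open>The origin of the threshold \<open>exp (- 2)\<close>: the denominator
  \<open>s * (ln s)\<^sup>2\<close> has derivative \<open>(ln s + 2) * ln s\<close>, which is
  nonnegative once \<open>ln s \<le> - 2\<close>.\<close>

lemma invlog'_antimono:
  assumes "0 < s" "s \<le> t" "t \<le> exp (- 2)"
  shows "invlog' t \<le> invlog' s"
proof -
  have "\<exists>y. ((\<lambda>s. s * (ln s)\<^sup>2) has_real_derivative y) (at x) \<and> 0 \<le> y"
    if "s \<le> x" "x \<le> t" for x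
  proof (intro exI conjI)
    have x: "0 < x" "ln x \<le> - 2" using that assms ln_le_m2[of x] by auto
    show "((\<lambda>s. s * (ln s)\<^sup>2) has_real_derivative (ln x + 2) * ln x) (at x)"
      using x by (auto intro!: derivative_eq_intros simp: power2_eq_square algebra_simps)
    show "0 \<le> (ln x + 2) * ln x" by (intro mult_nonpos_nonpos; use x(2) in linarith)
  qed
  from DERIV_nonneg_imp_nondecreasing[OF assms(2) this]
  have "s * (ln s)\<^sup>2 \<le> t * (ln t)\<^sup>2" .
  moreover have "ln s \<le> - 2" using assms by (intro ln_le_m2) auto
  then have "0 < s * (ln s)\<^sup>2" using assms(1) by (intro mult_pos_pos) auto
  ultimately show ?thesis
    unfolding invlog'_def by (simp add: frac_le)
qed

text \<open>Half the square of \<open>invlog\<close> and its first two derivatives. As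
  \<open>ln s\<close> is negative in the range used, \<open>hsq'\<close> is positive there, whereas
  \<open>hsq''\<close> is negative for \<open>s < exp (- 3)\<close>. So \<open>hsq\<close> is not
  convex, and the second derivatives of \<open>h\<close> have to compensate.\<close>

definition hsq :: "real \<Rightarrow> real" where "hsq s = 1 / (2 * (ln s)\<^sup>2)"
definition hsq' :: "real \<Rightarrow> real" where "hsq' s = - 1 / (s * (ln s) ^ 3)"
definition hsq'' :: "real \<Rightarrow> real" where
  "hsq'' s = 1 / (s\<^sup>2 * (ln s) ^ 3) + 3 / (s\<^sup>2 * (ln s) ^ 4)"

lemma hsq_has_derivative:
  assumes "0 < s" "s \<le> exp (- 2)"
  shows "(hsq has_real_derivative hsq' s) (at s)"
proof -
  have "ln s \<noteq> 0" using ln_le_m2[OF assms] by auto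
  then show ?thesis
    unfolding hsq_def[abs_def] hsq'_def using assms(1)
    by (auto intro!: derivative_eq_intros simp: field_simps power2_eq_square power3_eq_cube)
qed

lemma hsq'_has_derivative:
  assumes "0 < s" "s \<le> exp (- 2)"
  shows "(hsq' has_real_derivative hsq'' s) (at s)"
proof -
  have L: "ln s \<noteq> 0" using ln_le_m2[OF assms] by auto
  have "((\<lambda>s. s * (ln s) ^ 3) has_real_derivative (ln s) ^ 3 + 3 * (ln s)\<^sup>2) (at s)"
    using assms(1) by (auto intro!: derivative_eq_intros)
  then have "((\<lambda>s. - 1 / (s * (ln s) ^ 3)) has_real_derivative
     ((ln s) ^ 3 + 3 * (ln s)\<^sup>2) / (s * (ln s) ^ 3)\<^sup>2) (at s)"
    using DERIV_divide[OF DERIV_const[of "- 1"], of "\<lambda>s. s * (ln s) ^ 3" _ s UNIV] assms(1) L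
    by (simp add: power2_eq_square)
  moreover have "((ln s) ^ 3 + 3 * (ln s)\<^sup>2) / (s * (ln s) ^ 3)\<^sup>2 = hsq'' s"
    unfolding hsq''_def using L assms(1) by (simp add: field_simps eval_nat_numeral)
  ultimately show ?thesis
    unfolding hsq'_def[abs_def] by simp
qed

text \<open>In complex terms: \<open>invlog \<circ> exp\<close> is convex and increasing, so \<open>invlog (h + \<epsilon>)\<close> is subharmonic
  whenever \<open>ln h\<close> is; hence half its square has Laplacian at least its squared gradient.\<close>

lemma hsq_laplacian_ge:
  assumes s: "0 < s" "s \<le> exp (- 2)" and h: "0 \<le> h" "h \<le> s"
    and P: "0 \<le> p1 + p2" "h1\<^sup>2 + h2\<^sup>2 \<le> h * (p1 + p2)"
  shows "(invlog' s * h1)\<^sup>2 + (invlog' s * h2)\<^sup>2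
    \<le> (hsq'' s * h1\<^sup>2 + hsq' s * p1) + (hsq'' s * h2\<^sup>2 + hsq' s * p2)"
proof -
  define L where "L = - ln s"
  have L: "0 < L" "ln s = - L" using ln_le_m2[OF s] by (auto simp: L_def)
  define N where "N = h1\<^sup>2 + h2\<^sup>2"
  have N: "0 \<le> N" by (simp add: N_def)
  \<comment> \<open>Since \<open>p1 + p2\<close> is nonnegative, the inequality for \<open>h\<close>
    survives the passage to the larger \<open>s\<close>. It then absorbs the only negative term,
    \<open>- N / (s\<^sup>2 * L ^ 3)\<close>. Of the remaining
    \<open>3 * N / (s\<^sup>2 * L ^ 4)\<close> one third is the squared gradient and the rest is
    surplus.\<close>
  have "h * (p1 + p2) \<le> s * (p1 + p2)" using h P(1) by (intro mult_right_mono)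
  then have "N \<le> s * (p1 + p2)" using P(2) by (simp add: N_def)
  then have "N / s / (s * L ^ 3) \<le> (p1 + p2) / (s * L ^ 3)"
    using s L by (intro divide_right_mono) (auto simp: field_simps)
  then have "0 \<le> (p1 + p2) / (s * L ^ 3) - N / (s\<^sup>2 * L ^ 3)"
    by (simp add: power2_eq_square mult.assoc)
  moreover have "0 \<le> 2 * N / (s\<^sup>2 * L ^ 4)" using N by simp
  moreover have "(hsq'' s * h1\<^sup>2 + hsq' s * p1) + (hsq'' s * h2\<^sup>2 + hsq' s * p2)
      = N * (3 / (s\<^sup>2 * L ^ 4) - 1 / (s\<^sup>2 * L ^ 3)) + (p1 + p2) / (s * L ^ 3)"
    unfolding hsq''_def hsq'_def L(2) N_def using s L by (simp add: algebra_simps add_divide_distrib)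
  moreover have "(invlog' s * h1)\<^sup>2 + (invlog' s * h2)\<^sup>2 = N / (s\<^sup>2 * L ^ 4)"
    unfolding invlog'_def L(2) N_def
    by (simp add: power_mult_distrib power_divide add_divide_distrib flip: power_mult)
  ultimately show ?thesis
    by (simp add: algebra_simps)
qed

section \<open>The Caccioppoli inequality\<close>

lemma bounded_image_mult:
  fixes f g :: "'a \<Rightarrow> real"
  assumes "bounded (f ` W)" "bounded (g ` W)"
  shows "bounded ((\<lambda>x. f x * g x) ` W)"
proof -
  obtain a b where "\<And>x. x \<in> W \<Longrightarrow> \<bar>f x\<bar> \<le> a" "\<And>x. x \<in> W \<Longrightarrow> \<bar>g x\<bar> \<le> b"
    using assms by (auto simp: bounded_iff)
  then have "\<bar>f x * g x\<bar> \<le> a * b" if "x \<in> W" for x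
    unfolding abs_mult using that by (intro mult_mono') auto
  then show ?thesis by (auto simp: bounded_iff)
qed

lemma bounded_image_continuous_ball:
  fixes f :: "'a::euclidean_space \<Rightarrow> real"
  assumes "continuous_on UNIV f"
  shows "bounded (f ` ball p R)"
proof -
  have "compact (f ` cball p R)"
    using assms by (intro compact_continuous_image) (auto intro: continuous_on_subset)
  then show ?thesis
    by (meson bounded_subset compact_imp_bounded image_mono ball_subset_cball)
qed

lemma borel_measurable_indicator_mult:
  fixes f g :: "'a::topological_space \<Rightarrow> real"
  assumes "(\<lambda>x. indicator W x * f x) \<in> borel_measurable borel"
    "(\<lambda>x. indicator W x * g x) \<in> borel_measurable borel"
  shows "(\<lambda>x. indicator W x * (f x * g x)) \<in> borel_measurable borel"
proof -
  have "(\<lambda>x. indicator W x * (f x * g x)) = (\<lambda>x. (indicator W x * f x) * (indicator W x * g x))"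
    by (auto simp: indicator_def)
  then show ?thesis using assms by simp
qed

lemma borel_measurable_indicator_continuous:
  fixes f :: "'a::topological_space \<Rightarrow> real"
  assumes "open W" "continuous_on W f"
  shows "(\<lambda>x. indicator W x * f x) \<in> borel_measurable borel"
  using borel_measurable_continuous_on_indicator[of W f] assms by simp

text \<open>Both \<open>h\<close> and the regularising constant are kept below
  \<open>exp (- 3)\<close>, so that their sum stays in the range where the facts about
  \<open>invlog\<close> hold.\<close>

lemma two_exp_m3: "2 * exp (- 3) \<le> exp (- 2 :: real)"
proof -
  have "2 * exp (- 3) \<le> exp 1 * exp (- 3 :: real)"
    using exp_ge_add_one_self[of 1] by (intro mult_right_mono) auto
  then show ?thesis by (simp flip: exp_add)
qed

text \<open>These bounds depend on \<open>\<epsilon>\<close>. They only justify integrating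
  derivatives; the energy estimate itself rests on the uniform bound
  \<open>hsq s \<le> 1\<close>.\<close>

lemma hsq_bounded:
  assumes "0 < \<epsilon>"
  shows "bounded (hsq ` {\<epsilon>..exp (- 2)})" "bounded (hsq' ` {\<epsilon>..exp (- 2)})"
    "bounded (hsq'' ` {\<epsilon>..exp (- 2)})"
proof -
  have "ln s \<noteq> 0" if "s \<in> {\<epsilon>..exp (- 2)}" for s
    using ln_le_m2[of s] that assms by auto
  then have "continuous_on {\<epsilon>..exp (- 2)} hsq" "continuous_on {\<epsilon>..exp (- 2)} hsq'"
    "continuous_on {\<epsilon>..exp (- 2)} hsq''"
    unfolding hsq_def[abs_def] hsq'_def[abs_def] hsq''_def[abs_def] using assms
    by (auto intro!: continuous_intros)
  then show "bounded (hsq ` {\<epsilon>..exp (- 2)})" "bounded (hsq' ` {\<epsilon>..exp (- 2)})"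
    "bounded (hsq'' ` {\<epsilon>..exp (- 2)})"
    by (auto intro!: compact_imp_bounded compact_continuous_image)
qed

text \<open>Two integrations by parts at once. With \<open>Q = hsq (h + \<epsilon>)\<close>, the
  integrand \<open>F\<close> is the derivative along \<open>b\<close> of
  \<open>Q' * \<eta> - Q * \<eta>'\<close>, in which the mixed terms \<open>Q' * \<eta>'\<close>
  cancel, and this function has compact support in \<open>W\<close>.\<close>

lemma hsq_cutoff_integral:
  fixes h :: "'a::euclidean_space \<Rightarrow> real"
  assumes W: "W = ball p R" and \<rho>: "\<rho> < R"
    and h: "continuous_on W h" "\<And>x. x \<in> W \<Longrightarrow> 0 \<le> h x" "\<And>x. x \<in> W \<Longrightarrow> h x \<le> exp (- 3)"
    and d: "\<And>x. x \<in> W \<Longrightarrow> has_dir_derivative h b x (h1 x)"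
      "\<And>x. x \<in> W \<Longrightarrow> has_dir_derivative h1 b x (h2 x)"
    and bd: "bounded (h1 ` W)" "bounded (h2 ` W)"
    and \<epsilon>: "0 < \<epsilon>" "\<epsilon> \<le> exp (- 3)"
    and \<eta>: "continuous_on UNIV \<eta>" "continuous_on UNIV \<eta>1" "continuous_on UNIV \<eta>2"
      "\<And>x. has_dir_derivative \<eta> b x (\<eta>1 x)" "\<And>x. has_dir_derivative \<eta>1 b x (\<eta>2 x)"
      "\<And>x. x \<notin> cball p \<rho> \<Longrightarrow> \<eta> x = 0" "\<And>x. x \<notin> cball p \<rho> \<Longrightarrow> \<eta>1 x = 0"
  defines "F \<equiv> \<lambda>x. (hsq'' (h x + \<epsilon>) * (h1 x)\<^sup>2 + hsq' (h x + \<epsilon>) * h2 x) * \<eta> x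
      - hsq (h x + \<epsilon>) * \<eta>2 x"
  shows "integrable lborel (\<lambda>x. indicator W x * F x)"
    "(\<integral>x. indicator W x * F x \<partial>lborel) = 0"
proof -
  have oW: "open W" by (simp add: W)
  have s: "h x + \<epsilon> \<in> {\<epsilon>..exp (- 2)}" if "x \<in> W" for x
    using h(2,3)[OF that] \<epsilon> two_exp_m3 by simp
  have s0: "0 < h x + \<epsilon>" "h x + \<epsilon> \<le> exp (- 2)" if "x \<in> W" for x
    using s[OF that] \<epsilon> by auto
  note bounds = hsq_bounded[OF \<epsilon>(1)]
  have bQ: "bounded ((\<lambda>x. hsq (h x + \<epsilon>)) ` W)" "bounded ((\<lambda>x. hsq' (h x + \<epsilon>)) ` W)"
    "bounded ((\<lambda>x. hsq'' (h x + \<epsilon>)) ` W)"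
    by (rule bounded_subset[OF bounds(1)] bounded_subset[OF bounds(2)] bounded_subset[OF bounds(3)];
        use s in blast)+
  have b\<eta>: "bounded (\<eta> ` W)" "bounded (\<eta>1 ` W)" "bounded (\<eta>2 ` W)"
    using \<eta>(1-3) by (auto simp: W intro: bounded_image_continuous_ball)
  have d\<epsilon>: "has_dir_derivative (\<lambda>x. h x + \<epsilon>) b x (h1 x)" if "x \<in> W" for x
    using has_dir_derivative_add[OF d(1)[OF that] has_dir_derivative_const[of \<epsilon>]] by simp
  define g where "g x = (hsq' (h x + \<epsilon>) * h1 x) * \<eta> x - hsq (h x + \<epsilon>) * \<eta>1 x" for x
  have dg: "has_dir_derivative g b x (F x)" if x: "x \<in> W" for x
  proof -
    have "has_dir_derivative g b x
      (((hsq'' (h x + \<epsilon>) * h1 x) * h1 x + hsq' (h x + \<epsilon>) * h2 x) * \<eta> x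
         + (hsq' (h x + \<epsilon>) * h1 x) * \<eta>1 x
       - ((hsq' (h x + \<epsilon>) * h1 x) * \<eta>1 x + hsq (h x + \<epsilon>) * \<eta>2 x))"
      unfolding g_def[abs_def]
      by (intro has_dir_derivative_diff has_dir_derivative_mult d x \<eta>(4,5)
          has_dir_derivative_compose[OF d\<epsilon>[OF x]] hsq_has_derivative hsq'_has_derivative s0)
    then show ?thesis by (simp add: F_def power2_eq_square mult.assoc)
  qed
  have cQ: "continuous_on W (\<lambda>x. hsq (h x + \<epsilon>))" "continuous_on W (\<lambda>x. hsq' (h x + \<epsilon>))"
  proof -
    have "continuous_on {\<epsilon>..exp (- 2)} hsq" "continuous_on {\<epsilon>..exp (- 2)} hsq'"
      using \<epsilon> by (auto intro!: continuous_at_imp_continuous_on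
          DERIV_isCont[OF hsq_has_derivative] DERIV_isCont[OF hsq'_has_derivative])
    note * = this
    have "continuous_on W (\<lambda>x. h x + \<epsilon>)" by (intro continuous_intros h(1))
    note ** = continuous_on_compose2[OF *(1) this] continuous_on_compose2[OF *(2) this]
    show "continuous_on W (\<lambda>x. hsq (h x + \<epsilon>))" by (rule **(1)) (use s in blast)
    show "continuous_on W (\<lambda>x. hsq' (h x + \<epsilon>))" by (rule **(2)) (use s in blast)
  qed
  have mg: "(\<lambda>x. indicator W x * g x) \<in> borel_measurable borel"
    unfolding g_def right_diff_distrib
    by (intro borel_measurable_diff borel_measurable_indicator_mult
        borel_measurable_dir_derivative[OF oW _ d(1)] borel_measurable_indicator_continuous[OF oW]
        cQ h(1) continuous_on_subset[OF \<eta>(1)] continuous_on_subset[OF \<eta>(2)]) auto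
  have bg: "bounded (g ` W)" "bounded (F ` W)"
    unfolding g_def F_def power2_eq_square
    by (intro bounded_minus_comp bounded_plus_comp bounded_image_mult bQ b\<eta> bd)+
  have K: "cball p \<rho> \<subseteq> W" using \<rho> by (auto simp: W)
  have g0: "g x = 0" if "x \<in> W - cball p \<rho>" for x
    using \<eta>(6,7) that by (simp add: g_def)
  show "integrable lborel (\<lambda>x. indicator W x * F x)"
    by (rule integral_dir_derivative_eq_0_on(1)[OF oW compact_cball K g0 mg bg(1) dg bg(2)])
  show "(\<integral>x. indicator W x * F x \<partial>lborel) = 0"
    by (rule integral_dir_derivative_eq_0_on(2)[OF oW compact_cball K g0 mg bg(1) dg bg(2)])
qed

text \<open>The Caccioppoli inequality for the bounded subharmonic functions \<open>invlog (h + \<epsilon>)\<close>: testing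
  the Laplacian of half their square against a cutoff bounds their energy uniformly in \<open>\<epsilon>\<close>.\<close>

lemma invlog_energy_bound:
  fixes h :: "'a::euclidean_space \<Rightarrow> real"
  assumes W: "W = ball p R" and r: "0 < r" "r < R"
    and h: "continuous_on W h" "\<And>x. x \<in> W \<Longrightarrow> 0 \<le> h x" "\<And>x. x \<in> W \<Longrightarrow> h x \<le> exp (- 3)"
    and d: "\<And>x. x \<in> W \<Longrightarrow> has_dir_derivative h b x (h1 x)"
      "\<And>x. x \<in> W \<Longrightarrow> has_dir_derivative h1 b x (h2 x)"
    and bd: "bounded (h1 ` W)" "bounded (h2 ` W)"
    and k: "\<And>x. x \<in> W \<Longrightarrow> has_dir_derivative h c x (k1 x)"
      "\<And>x. x \<in> W \<Longrightarrow> has_dir_derivative k1 c x (k2 x)"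
    and bk: "bounded (k1 ` W)" "bounded (k2 ` W)"
    and P: "\<And>x. x \<in> W \<Longrightarrow> 0 \<le> h2 x + k2 x"
      "\<And>x. x \<in> W \<Longrightarrow> (h1 x)\<^sup>2 + (k1 x)\<^sup>2 \<le> h x * (h2 x + k2 x)"
  shows "\<exists>C. \<forall>\<epsilon>. 0 < \<epsilon> \<and> \<epsilon> \<le> exp (- 3) \<longrightarrow>
    (\<integral>\<^sup>+x. ennreal (indicator (ball p r) x * (invlog' (h x + \<epsilon>) * h1 x)\<^sup>2) \<partial>lborel) \<le> ennreal C"
proof -
  \<comment> \<open>The cutoff has to be bounded below on \<open>ball p r\<close> and yet have
    compact support in \<open>W\<close>; an intermediate radius leaves room for both.\<close>
  define \<rho> where "\<rho> = (r + R) / 2"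
  have \<rho>: "r < \<rho>" "\<rho> < R" using r by (auto simp: \<rho>_def)
  obtain \<eta> :: "'a \<Rightarrow> real" and \<eta>1 \<eta>2 :: "'a \<Rightarrow> 'a \<Rightarrow> real" and \<gamma> :: real
    where \<eta>: "continuous_on UNIV \<eta>" "\<And>b. continuous_on UNIV (\<eta>1 b)" "\<And>b. continuous_on UNIV (\<eta>2 b)"
      "\<And>b x. has_dir_derivative \<eta> b x (\<eta>1 b x)" "\<And>b x. has_dir_derivative (\<eta>1 b) b x (\<eta>2 b x)"
      and \<eta>0: "\<And>x. 0 \<le> \<eta> x" and \<gamma>: "0 < \<gamma>" "\<And>x. x \<in> ball p r \<Longrightarrow> \<gamma> \<le> \<eta> x"
      and \<eta>': "\<And>x. x \<notin> cball p \<rho> \<Longrightarrow> \<eta> x = 0" "\<And>b x. x \<notin> cball p \<rho> \<Longrightarrow> \<eta>1 b x = 0"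
    by (rule cutoff_exists[OF r(1) \<rho>(1), of p]) blast
  have "bounded (\<eta>2 b ` W)" "bounded (\<eta>2 c ` W)"
    using \<eta>(3) by (auto simp: W intro: bounded_image_continuous_ball)
  then obtain E1 E2 where E: "\<And>x. x \<in> W \<Longrightarrow> \<bar>\<eta>2 b x\<bar> \<le> E1" "\<And>x. x \<in> W \<Longrightarrow> \<bar>\<eta>2 c x\<bar> \<le> E2"
    by (auto simp: bounded_iff)
  have pW: "p \<in> W" using r by (simp add: W)
  have E0: "0 \<le> E1 + E2" using E[OF pW] by linarith
  have VW: "ball p r \<subseteq> W" using r by (auto simp: W)
  define C where "C = 1 / \<gamma> * ((E1 + E2) * measure lborel W)"
  have "(\<integral>\<^sup>+x. ennreal (indicator (ball p r) x * (invlog' (h x + \<epsilon>) * h1 x)\<^sup>2) \<partial>lborel)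
      \<le> ennreal C" if \<epsilon>: "0 < \<epsilon>" "\<epsilon> \<le> exp (- 3)" for \<epsilon>
  proof -
    define F where "F = (\<lambda>x. (hsq'' (h x + \<epsilon>) * (h1 x)\<^sup>2 + hsq' (h x + \<epsilon>) * h2 x) * \<eta> x
      - hsq (h x + \<epsilon>) * \<eta>2 b x)"
    define G where "G = (\<lambda>x. (hsq'' (h x + \<epsilon>) * (k1 x)\<^sup>2 + hsq' (h x + \<epsilon>) * k2 x) * \<eta> x
      - hsq (h x + \<epsilon>) * \<eta>2 c x)"
    have F: "integrable lborel (\<lambda>x. indicator W x * F x)"
      "(\<integral>x. indicator W x * F x \<partial>lborel) = 0"
      unfolding F_def by (rule hsq_cutoff_integral[OF W \<rho>(2) h d bd \<epsilon> \<eta>(1) \<eta>(2,3)[of b]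
            \<eta>(4,5)[of b] \<eta>'(1) \<eta>'(2)[of _ b]]; assumption)+
    have G: "integrable lborel (\<lambda>x. indicator W x * G x)"
      "(\<integral>x. indicator W x * G x \<partial>lborel) = 0"
      unfolding G_def by (rule hsq_cutoff_integral[OF W \<rho>(2) h k bk \<epsilon> \<eta>(1) \<eta>(2,3)[of c]
            \<eta>(4,5)[of c] \<eta>'(1) \<eta>'(2)[of _ c]]; assumption)+
    \<comment> \<open>\<open>F\<close> and \<open>G\<close> integrate to \<open>0\<close>, so this
      majorant has integral \<open>C\<close>, in which \<open>\<epsilon>\<close> does not occur:
      \<open>E1\<close> and \<open>E2\<close> bound second derivatives of the cutoff alone.\<close>
    define H where "H x = 1 / \<gamma> * (indicator W x * F x + indicator W x * G x + indicator W x * (E1 + E2))"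
      for x
    have iW: "integrable lborel (\<lambda>x. indicator W x * (E1 + E2))"
      using emeasure_bounded_finite[of W]
      by (intro integrable_mult_left integrable_real_indicator) (auto simp: W)
    have iH: "integrable lborel H"
      unfolding H_def by (intro integrable_mult_right Bochner_Integration.integrable_add F G iW)
    have intH: "(\<integral>x. H x \<partial>lborel) = C"
      unfolding H_def C_def using F G iW by (simp add: W)
    have le: "indicator (ball p r) x * (invlog' (h x + \<epsilon>) * h1 x)\<^sup>2 \<le> H x" for x
    proof (cases "x \<in> W")
      case True
      define s where "s = h x + \<epsilon>"
      have s: "0 < s" "s \<le> exp (- 2)" "h x \<le> s"
        using h(2,3)[OF True] \<epsilon> two_exp_m3 by (auto simp: s_def)
      have Q: "0 \<le> hsq s" "hsq s \<le> 1"
      proof -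
        have "2\<^sup>2 \<le> (- ln s)\<^sup>2" using ln_le_m2[OF s(1,2)] by (intro power_mono) auto
        then show "0 \<le> hsq s" "hsq s \<le> 1" by (auto simp: hsq_def divide_le_eq)
      qed
      have "\<bar>hsq s * \<eta>2 b x\<bar> \<le> 1 * E1" "\<bar>hsq s * \<eta>2 c x\<bar> \<le> 1 * E2"
        unfolding abs_mult using Q E[OF True] by (intro mult_mono; simp)+
      then have Q\<eta>: "- E1 \<le> - (hsq s * \<eta>2 b x)" "- E2 \<le> - (hsq s * \<eta>2 c x)" by auto
      have "(invlog' s * h1 x)\<^sup>2 + (invlog' s * k1 x)\<^sup>2
          \<le> (hsq'' s * (h1 x)\<^sup>2 + hsq' s * h2 x) + (hsq'' s * (k1 x)\<^sup>2 + hsq' s * k2 x)"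
        by (rule hsq_laplacian_ge[OF s(1,2) h(2)[OF True] s(3) P[OF True]])
      then have "((invlog' s * h1 x)\<^sup>2 + (invlog' s * k1 x)\<^sup>2) * \<eta> x
          \<le> ((hsq'' s * (h1 x)\<^sup>2 + hsq' s * h2 x) + (hsq'' s * (k1 x)\<^sup>2 + hsq' s * k2 x)) * \<eta> x"
        using \<eta>0 by (rule mult_right_mono)
      also have "\<dots> \<le> F x + G x + (E1 + E2)"
        using Q\<eta> by (simp add: F_def G_def s_def algebra_simps)
      finally have *: "((invlog' s * h1 x)\<^sup>2 + (invlog' s * k1 x)\<^sup>2) * \<eta> x \<le> F x + G x + (E1 + E2)" .
      have "\<gamma> * (indicator (ball p r) x * (invlog' s * h1 x)\<^sup>2) \<le> (invlog' s * h1 x)\<^sup>2 * \<eta> x"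
        using \<gamma>(2)[of x] \<eta>0[of x] by (auto simp: indicator_def mult.commute intro: mult_right_mono)
      also have "\<dots> \<le> ((invlog' s * h1 x)\<^sup>2 + (invlog' s * k1 x)\<^sup>2) * \<eta> x"
        using \<eta>0[of x] by (intro mult_right_mono) auto
      also note *
      finally have "indicator (ball p r) x * (invlog' s * h1 x)\<^sup>2 \<le> (F x + G x + (E1 + E2)) / \<gamma>"
        using \<gamma>(1) by (simp only: pos_le_divide_eq mult.commute)
      then show ?thesis
        using True by (simp add: H_def s_def)
    next
      case False
      then show ?thesis using VW by (auto simp: H_def indicator_def)
    qed
    have H0: "0 \<le> H x" for x
      by (rule order_trans[OF _ le]) (auto simp: indicator_def)
    have "(\<integral>\<^sup>+x. ennreal (indicator (ball p r) x * (invlog' (h x + \<epsilon>) * h1 x)\<^sup>2) \<partial>lborel)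
        \<le> (\<integral>\<^sup>+x. ennreal (H x) \<partial>lborel)"
      by (intro nn_integral_mono ennreal_leI le)
    also have "\<dots> = ennreal C"
      using nn_integral_eq_integral[OF iH] H0 intH by simp
    finally show ?thesis .
  qed
  then show ?thesis by blast
qed

section \<open>Weak differentiability\<close>

text \<open>The estimates are made for \<open>lborel\<close> on a whole ball. Completion and
  restriction to compact subsets turn them into the local statements for
  \<open>lebesgue\<close>.\<close>

lemma set_integrable_lebesgue_subset:
  fixes f :: "'a::euclidean_space \<Rightarrow> 'b::euclidean_space"
  assumes "integrable lborel (\<lambda>x. indicator V x *\<^sub>R f x)" "compact K" "K \<subseteq> V"
  shows "set_integrable lebesgue K f"
proof -
  have "set_integrable lebesgue V f"
    using assms(1) unfolding set_integrable_def
    by (subst integrable_completion) auto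
  then show ?thesis
    by (rule set_integrable_subset) (use assms(2,3) in \<open>auto simp: compact_imp_closed\<close>)
qed

lemma integrable_indicator_bounded:
  fixes f :: "'a::euclidean_space \<Rightarrow> real"
  assumes m: "(\<lambda>x. indicator V x * f x) \<in> borel_measurable borel"
    and V: "bounded V" "V \<in> sets borel" and c: "\<And>x. x \<in> V \<Longrightarrow> \<bar>f x\<bar> \<le> c"
  shows "integrable lborel (\<lambda>x. indicator V x * f x)"
proof (rule integrableI_bounded_set[of V])
  show "emeasure lborel V < \<infinity>" by (rule emeasure_bounded_finite[OF V(1)])
  show "AE x in lborel. x \<in> V \<longrightarrow> norm (indicator V x * f x) \<le> c"
    using c by (intro AE_I2) simp
qed (use m V in auto)

lemma L1_locI:
  fixes f :: "'a::euclidean_space \<Rightarrow> 'b::euclidean_space"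
  assumes "integrable lborel (\<lambda>x. indicator V x *\<^sub>R f x)"
  shows "L1_loc V f"
  unfolding L1_loc_def set_borel_measurable_def
  using assms set_integrable_lebesgue_subset[OF assms]
  by (auto intro: measurable_completion)

lemma L2_locI:
  fixes f :: "'a::euclidean_space \<Rightarrow> 'b::euclidean_space"
  assumes "(\<lambda>x. indicator V x *\<^sub>R f x) \<in> borel_measurable borel"
    "integrable lborel (\<lambda>x. indicator V x *\<^sub>R (norm (f x))\<^sup>2)"
  shows "L2_loc V f"
  unfolding L2_loc_def set_borel_measurable_def
  using assms(1) set_integrable_lebesgue_subset[OF assms(2)]
  by (auto intro: measurable_completion)

lemma test_functionD:
  fixes \<phi> :: "'a::euclidean_space \<Rightarrow> real"
  assumes "test_function V \<phi>" "b \<in> Basis"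
  shows "continuous_on UNIV \<phi>" "continuous_on UNIV (\<lambda>x. frechet_derivative \<phi> (at x) b)"
    "has_dir_derivative \<phi> b x (frechet_derivative \<phi> (at x) b)"
proof -
  have C: "C_k k \<phi>" for k using assms(1) by (simp add: test_function_def)
  show "continuous_on UNIV \<phi>" using C[of 0] by simp
  show "continuous_on UNIV (\<lambda>x. frechet_derivative \<phi> (at x) b)"
    using C[of "Suc 0"] assms(2) by simp
  have "\<phi> differentiable (at x)" using C[of "Suc 0"] by simp
  then show "has_dir_derivative \<phi> b x (frechet_derivative \<phi> (at x) b)"
    by (intro has_derivative_imp_has_dir_derivative) (simp add: frechet_derivative_works)
qed

lemma invlog'_continuous: "0 < s \<Longrightarrow> s \<le> exp (- 2) \<Longrightarrow> isCont invlog' s"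
  unfolding invlog'_def[abs_def] using ln_le_m2[of s] by (intro continuous_intros) auto

text \<open>At zeros of \<open>h\<close> the gradient candidate below vanishes because \<open>invlog' 0 = 0\<close>; it dominates
  the gradients of the regularisations \<open>invlog (h + \<epsilon>)\<close> because \<open>invlog'\<close> is decreasing.\<close>

lemma W12_loc_invlog:
  fixes h :: "'a::euclidean_space \<Rightarrow> real" and h1 h2 :: "'a \<Rightarrow> 'a \<Rightarrow> real"
  assumes W: "W = ball p R" and V: "V = ball p r" and r: "0 < r" "r < R"
    and h: "continuous_on W h" "\<And>x. x \<in> W \<Longrightarrow> 0 \<le> h x" "\<And>x. x \<in> W \<Longrightarrow> h x \<le> exp (- 3)"
    and d: "\<And>b x. b \<in> Basis \<Longrightarrow> x \<in> W \<Longrightarrow> has_dir_derivative h b x (h1 b x)"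
      "\<And>b x. b \<in> Basis \<Longrightarrow> x \<in> W \<Longrightarrow> has_dir_derivative (h1 b) b x (h2 b x)"
    and bd: "\<And>b. b \<in> Basis \<Longrightarrow> bounded (h1 b ` W)" "\<And>b. b \<in> Basis \<Longrightarrow> bounded (h2 b ` W)"
    and P: "\<And>b. b \<in> Basis \<Longrightarrow> \<exists>c\<in>Basis. \<forall>x\<in>W. 0 \<le> h2 b x + h2 c x \<and>
      (h1 b x)\<^sup>2 + (h1 c x)\<^sup>2 \<le> h x * (h2 b x + h2 c x)"
  shows "W12_loc V (\<lambda>x. invlog (h x))"
proof -
  \<comment> \<open>A sequence of regularising constants in \<open>(0, exp (- 3)]\<close>, since
    Fatou's lemma and dominated convergence are to be applied.\<close>
  define e where "e n = exp (- 3) / real (Suc n)" for n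
  have e: "0 < e n" "e n \<le> exp (- 3)" for n
    by (auto simp: e_def field_simps)
  have e0: "e \<longlonglongrightarrow> 0"
    unfolding e_def by real_asymp
  have VW: "V \<subseteq> W" and oV: "open V" and oW: "open W" using r by (auto simp: V W)
  have [measurable]: "V \<in> sets borel" using oV by simp
  have finV: "emeasure lborel V < \<infinity>"
    unfolding V by (rule emeasure_bounded_finite) simp
  define u where "u = (\<lambda>x. invlog (h x))"
  define g where "g b x = invlog' (h x) * h1 b x" for b x
  define gn where "gn b n x = invlog' (h x + e n) * h1 b x" for b n x
  have hV: "0 \<le> h x" "h x \<le> exp (- 2)" "0 < h x + e n" "h x + e n \<le> exp (- 2)" if "x \<in> V" for x n
    using h(2,3)[of x] that VW e[of n] two_exp_m3 exp_gt_zero[of "-3 :: real"] by (auto simp: subset_iff)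
  \<comment> \<open>At a zero of \<open>h\<close> the factor \<open>invlog' (e n)\<close> grows
    without bound as \<open>n\<close> increases; the vanishing of \<open>h1\<close> is what keeps
    \<open>gn b n x\<close> equal to \<open>0\<close> there.\<close>
  have h1_0: "h1 b x = 0" if b: "b \<in> Basis" and x: "x \<in> V" and hx: "h x = 0" for b x
  proof -
    obtain c where "(h1 b x)\<^sup>2 + (h1 c x)\<^sup>2 \<le> h x * (h2 b x + h2 c x)"
      using P[OF b] x VW by blast
    then have "(h1 b x)\<^sup>2 + (h1 c x)\<^sup>2 \<le> 0" using hx by simp
    then show ?thesis by (simp add: sum_power2_le_zero_iff)
  qed
  have gn_le: "\<bar>gn b n x\<bar> \<le> \<bar>g b x\<bar>" if "b \<in> Basis" "x \<in> V" for b n x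
  proof (cases "h x = 0")
    case True
    then show ?thesis using h1_0[OF that] by (simp add: gn_def)
  next
    case False
    then have "invlog' (h x + e n) \<le> invlog' (h x)"
      using hV[OF that(2)] e[of n] by (intro invlog'_antimono) (auto simp: less_le)
    then show ?thesis
      unfolding gn_def g_def abs_mult
      using hV[OF that(2)] by (intro mult_right_mono) (auto simp: invlog'_nonneg less_imp_le)
  qed
  have gn_lim: "(\<lambda>n. gn b n x) \<longlonglongrightarrow> g b x" if "b \<in> Basis" "x \<in> V" for b x
  proof (cases "h x = 0")
    case True
    then show ?thesis using h1_0[OF that] by (simp add: gn_def g_def)
  next
    case False
    then have "isCont invlog' (h x)"
      using hV[OF that(2)] by (intro invlog'_continuous) (auto simp: less_le)
    moreover have "(\<lambda>n. h x + e n) \<longlonglongrightarrow> h x"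
      using tendsto_add[OF tendsto_const e0] by simp
    ultimately have "(\<lambda>n. invlog' (h x + e n)) \<longlonglongrightarrow> invlog' (h x)"
      by (rule isCont_tendsto_compose)
    then show ?thesis unfolding gn_def g_def by (intro tendsto_mult tendsto_const)
  qed
  have hm[measurable]: "(\<lambda>x. indicator V x * h x) \<in> borel_measurable borel"
    using h(1) VW by (intro borel_measurable_indicator_continuous oV) (rule continuous_on_subset)
  have h1m[measurable]: "(\<lambda>x. indicator V x * h1 b x) \<in> borel_measurable borel" if "b \<in> Basis" for b
    by (rule borel_measurable_dir_derivative[OF oV hm]) (use d(1) that VW in auto)
  have gm[measurable]: "(\<lambda>x. indicator V x * g b x) \<in> borel_measurable borel"
    and gnm[measurable]: "(\<lambda>x. indicator V x * gn b n x) \<in> borel_measurable borel"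
    if b: "b \<in> Basis" for b n
  proof -
    note h1m[OF b, measurable]
    have "(\<lambda>x. indicator V x * g b x) =
        (\<lambda>x. invlog' (indicator V x * h x) * (indicator V x * h1 b x))"
      "(\<lambda>x. indicator V x * gn b n x) =
        (\<lambda>x. invlog' (indicator V x * h x + e n) * (indicator V x * h1 b x))"
      by (auto simp: g_def gn_def indicator_def)
    moreover have "invlog' \<in> borel_measurable borel"
      unfolding invlog'_def[abs_def] by measurable
    note this[measurable]
    ultimately show "(\<lambda>x. indicator V x * g b x) \<in> borel_measurable borel"
      "(\<lambda>x. indicator V x * gn b n x) \<in> borel_measurable borel"
      by (simp_all only:) measurable
  qed
  have uc: "continuous_on V u"
    unfolding u_def using h(1) VW hV
    by (intro continuous_on_compose2[OF continuous_invlog]) (auto intro: continuous_on_subset)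
  have um: "(\<lambda>x. indicator V x * u x) \<in> borel_measurable borel"
    by (rule borel_measurable_indicator_continuous[OF oV uc])
  have u01: "0 \<le> u x" "u x \<le> 1" if "x \<in> V" for x
    using hV[OF that] invlog_bounds by (auto simp: u_def)
  have iV: "integrable lborel (\<lambda>x. indicator V x * c)" for c :: real
    using finV by (intro integrable_mult_left integrable_real_indicator) auto
  have bV: "bounded V" "V \<in> sets borel" by (auto simp: V)
  have iu: "integrable lborel (\<lambda>x. indicator V x * u x)"
    by (rule integrable_indicator_bounded[OF um bV, of 1]) (use u01 in auto)
  have iu2: "integrable lborel (\<lambda>x. indicator V x * (u x)\<^sup>2)"
    unfolding power2_eq_square
    by (rule integrable_indicator_bounded[OF borel_measurable_indicator_mult[OF um um] bV, of 1])
      (use u01 in \<open>auto simp: abs_mult intro: mult_le_one\<close>)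
  have ig2: "integrable lborel (\<lambda>x. indicator V x * (g b x)\<^sup>2)" if b: "b \<in> Basis" for b
  proof (rule integrableI_nonneg)
    note gm[OF b, measurable] gnm[OF b, measurable]
    show "(\<lambda>x. indicator V x * (g b x)\<^sup>2) \<in> borel_measurable lborel"
      unfolding power2_eq_square using gm[OF b] by (simp add: borel_measurable_indicator_mult)
    show "AE x in lborel. 0 \<le> indicator V x * (g b x)\<^sup>2" by simp
    obtain c where c: "c \<in> Basis" "\<And>x. x \<in> W \<Longrightarrow> 0 \<le> h2 b x + h2 c x"
      "\<And>x. x \<in> W \<Longrightarrow> (h1 b x)\<^sup>2 + (h1 c x)\<^sup>2 \<le> h x * (h2 b x + h2 c x)"
      using P[OF b] by blast
    have "\<exists>C. \<forall>\<epsilon>. 0 < \<epsilon> \<and> \<epsilon> \<le> exp (- 3) \<longrightarrow>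
      (\<integral>\<^sup>+x. ennreal (indicator V x * (invlog' (h x + \<epsilon>) * h1 b x)\<^sup>2) \<partial>lborel) \<le> ennreal C"
      unfolding V by (rule invlog_energy_bound[OF W r h d[OF b] bd[OF b] d[OF c(1)] bd[OF c(1)] c(2,3)])
    then obtain C where C: "(\<integral>\<^sup>+x. ennreal (indicator V x * (gn b n x)\<^sup>2) \<partial>lborel) \<le> ennreal C" for n
      using e unfolding gn_def by blast
    have lim: "(\<lambda>n. ennreal (indicator V x * (gn b n x)\<^sup>2)) \<longlonglongrightarrow> ennreal (indicator V x * (g b x)\<^sup>2)" for x
      using gn_lim[OF b, of x] by (auto simp: indicator_def intro!: tendsto_intros)
    have "(\<integral>\<^sup>+x. ennreal (indicator V x * (g b x)\<^sup>2) \<partial>lborel) =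
        (\<integral>\<^sup>+x. liminf (\<lambda>n. ennreal (indicator V x * (gn b n x)\<^sup>2)) \<partial>lborel)"
      using lim_imp_Liminf[OF _ lim] by simp
    also have "\<dots> \<le> liminf (\<lambda>n. \<integral>\<^sup>+x. ennreal (indicator V x * (gn b n x)\<^sup>2) \<partial>lborel)"
      by (intro nn_integral_liminf measurable_compose[OF _ measurable_ennreal])
        (use gnm[OF b] in \<open>simp add: power2_eq_square borel_measurable_indicator_mult\<close>)
    also have "\<dots> \<le> liminf (\<lambda>n. ennreal C)"
      using C by (intro Liminf_mono always_eventually) auto
    also have "\<dots> < \<infinity>" by (simp add: Liminf_const)
    finally show "(\<integral>\<^sup>+x. ennreal (indicator V x * (g b x)\<^sup>2) \<partial>lborel) < \<infinity>" .
  qed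
  \<comment> \<open>\<open>V\<close> has finite measure, so
    \<open>\<bar>g\<bar> \<le> 1 + g\<^sup>2\<close> turns square integrability into
    integrability.\<close>
  have ig: "integrable lborel (\<lambda>x. indicator V x * g b x)" if b: "b \<in> Basis" for b
  proof (rule Bochner_Integration.integrable_bound[OF Bochner_Integration.integrable_add[OF iV[of 1] ig2[OF b]]])
    show "AE x in lborel. norm (indicator V x * g b x) \<le> norm (indicator V x * 1 + indicator V x * (g b x)\<^sup>2)"
    proof (rule AE_I2)
      fix x
      have "2 * \<bar>g b x\<bar> \<le> 1 + (g b x)\<^sup>2"
        using sum_squares_bound[of 1 "\<bar>g b x\<bar>"] by simp
      then show "norm (indicator V x * g b x) \<le> norm (indicator V x * 1 + indicator V x * (g b x)\<^sup>2)"
        by (auto simp: indicator_def)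
    qed
  qed (use gm[OF b] in simp)
  define G where "G x = (\<Sum>b\<in>Basis. g b x *\<^sub>R b)" for x
  have Gb: "G x \<bullet> b = g b x" if "b \<in> Basis" for x b
    using that by (simp add: G_def)
  have GV: "(\<lambda>x. indicator V x *\<^sub>R G x) = (\<lambda>x. \<Sum>b\<in>Basis. (indicator V x * g b x) *\<^sub>R b)"
    by (simp add: G_def scaleR_sum_right)
  have iG: "integrable lborel (\<lambda>x. indicator V x *\<^sub>R G x)"
    unfolding GV using ig by (intro Bochner_Integration.integrable_sum integrable_scaleR_left) auto
  have nG: "(norm (G x))\<^sup>2 = (\<Sum>b\<in>Basis. (g b x)\<^sup>2)" for x
  proof -
    have "(norm (G x))\<^sup>2 = (\<Sum>b\<in>Basis. (G x \<bullet> b) * (G x \<bullet> b))"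
      by (simp only: power2_norm_eq_inner euclidean_inner[of "G x" "G x"])
    also have "\<dots> = (\<Sum>b\<in>Basis. (g b x)\<^sup>2)"
      by (intro sum.cong) (auto simp: Gb power2_eq_square)
    finally show ?thesis .
  qed
  have iG2: "integrable lborel (\<lambda>x. indicator V x *\<^sub>R (norm (G x))\<^sup>2)"
    unfolding nG real_scaleR_def sum_distrib_left using ig2
    by (intro Bochner_Integration.integrable_sum) auto
  have L1: "L1_loc V u" "L1_loc V G" and L2: "L2_loc V u" "L2_loc V G"
    using iu iu2 iG iG2 um by (auto intro!: L1_locI L2_locI)
  have weak: "set_lebesgue_integral lebesgue V (\<lambda>x. u x * frechet_derivative \<phi> (at x) b) =
      - set_lebesgue_integral lebesgue V (\<lambda>x. (G x \<bullet> b) * \<phi> x)"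
    if \<phi>: "test_function V \<phi>" and b: "b \<in> Basis" for \<phi> b
  proof -
    define \<psi> where "\<psi> x = frechet_derivative \<phi> (at x) b" for x
    note \<phi>D = test_functionD[OF \<phi> b, folded \<psi>_def]
    define K where "K = closure {x. \<phi> x \<noteq> 0}"
    have K: "compact K" "K \<subseteq> V" using \<phi> by (auto simp: K_def test_function_def)
    have \<phi>0: "\<phi> x = 0" if "x \<in> V - K" for x
      using that closure_subset[of "{x. \<phi> x \<noteq> 0}"] by (auto simp: K_def)
    have b\<phi>: "bounded (\<phi> ` V)" "bounded (\<psi> ` V)"
      unfolding V using \<phi>D(1,2) by (auto intro: bounded_image_continuous_ball)
    have \<phi>m: "(\<lambda>x. indicator V x * \<phi> x) \<in> borel_measurable borel"
      "(\<lambda>x. indicator V x * \<psi> x) \<in> borel_measurable borel"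
      using \<phi>D(1,2) by (auto intro!: borel_measurable_indicator_continuous oV intro: continuous_on_subset)
    define F where "F n x = gn b n x * \<phi> x + invlog (h x + e n) * \<psi> x" for n x
    have dF: "has_dir_derivative (\<lambda>x. invlog (h x + e n) * \<phi> x) b x (F n x)" if x: "x \<in> V" for n x
    proof -
      have xW: "x \<in> W" using x VW by auto
      have "has_dir_derivative (\<lambda>x. h x + e n) b x (h1 b x)"
        using has_dir_derivative_add[OF d(1)[OF b xW] has_dir_derivative_const[of "e n"]] by simp
      from has_dir_derivative_compose[OF this invlog_has_derivative[OF hV(3,4)[OF x]]]
      have "has_dir_derivative (\<lambda>x. invlog (h x + e n)) b x (gn b n x)"
        by (simp add: gn_def)
      from has_dir_derivative_mult[OF this \<phi>D(3)] show ?thesis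
        by (simp add: F_def)
    qed
    have un: "0 \<le> invlog (h x + e n)" "invlog (h x + e n) \<le> 1" if "x \<in> V" for x n
      using hV(3,4)[OF that, of n] invlog_bounds[of "h x + e n"] by auto
    have bu: "bounded ((\<lambda>x. invlog (h x + e n)) ` V)" for n
      unfolding bounded_iff using un by (intro exI[of _ 1]) auto
    have bg: "bounded (gn b n ` V)" for n
    proof -
      \<comment> \<open>The bound \<open>invlog' (e n)\<close> depends on \<open>n\<close>, which is
        harmless: it only licenses integration by parts for the single regularisation.\<close>
      have "0 \<le> invlog' (h x + e n)" "invlog' (h x + e n) \<le> invlog' (e n)" if "x \<in> V" for x
        using hV[OF that] e[of n] by (auto intro!: invlog'_nonneg invlog'_antimono add_nonneg_nonneg
            simp: less_imp_le)
      then have "bounded ((\<lambda>x. invlog' (h x + e n)) ` V)"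
        unfolding bounded_iff by (intro exI[of _ "invlog' (e n)"]) auto
      then show ?thesis
        unfolding gn_def by (rule bounded_image_mult) (rule bounded_subset[OF bd(1)[OF b]], use VW in blast)
    qed
    have cu: "continuous_on V (\<lambda>x. invlog (h x + e n))" for n
      using h(1) VW hV(3,4)[of _ n]
      by (intro continuous_on_compose2[OF continuous_invlog])
        (auto intro!: continuous_intros simp: less_imp_le intro: continuous_on_subset)
    note mu = borel_measurable_indicator_continuous[OF oV cu]
    have F0: "(\<integral>x. indicator V x * F n x \<partial>lborel) = 0" for n
    proof (rule integral_dir_derivative_eq_0_on(2)[OF oV K _ _ _ dF])
      show "invlog (h x + e n) * \<phi> x = 0" if "x \<in> V - K" for x using \<phi>0[OF that] by simp
      show "(\<lambda>x. indicator V x * (invlog (h x + e n) * \<phi> x)) \<in> borel_measurable borel"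
        by (rule borel_measurable_indicator_mult[OF mu \<phi>m(1)])
      show "bounded ((\<lambda>x. invlog (h x + e n) * \<phi> x) ` V)"
        by (rule bounded_image_mult[OF bu b\<phi>(1)])
      show "bounded (F n ` V)"
        unfolding F_def by (intro bounded_plus_comp bounded_image_mult bg bu b\<phi>)
    qed
    obtain M1 M2 where M: "\<And>x. x \<in> V \<Longrightarrow> \<bar>\<phi> x\<bar> \<le> M1" "\<And>x. x \<in> V \<Longrightarrow> \<bar>\<psi> x\<bar> \<le> M2"
      using b\<phi> by (auto simp: bounded_iff)
    \<comment> \<open>A majorant independent of \<open>n\<close>, by \<open>gn_le\<close> and
      because the regularised functions take values in \<open>[0, 1]\<close>.\<close>
    define w where "w x = \<bar>indicator V x * g b x\<bar> * M1 + indicator V x * M2" for x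
    have iw: "integrable lborel w"
      unfolding w_def
      by (intro Bochner_Integration.integrable_add integrable_mult_left integrable_abs ig[OF b] iV)
    have i1: "integrable lborel (\<lambda>x. indicator V x * (g b x * \<phi> x))"
      "integrable lborel (\<lambda>x. indicator V x * (u x * \<psi> x))"
    proof -
      have "\<bar>g b x * \<phi> x\<bar> \<le> \<bar>g b x\<bar> * M1" "\<bar>u x * \<psi> x\<bar> \<le> 1 * M2" "0 \<le> M1" "0 \<le> M2"
        if "x \<in> V" for x
      proof -
        show "0 \<le> M1" "0 \<le> M2" using M[OF that] by linarith+
        show "\<bar>g b x * \<phi> x\<bar> \<le> \<bar>g b x\<bar> * M1" "\<bar>u x * \<psi> x\<bar> \<le> 1 * M2"
          unfolding abs_mult using M[OF that] u01[OF that] by (intro mult_mono; simp)+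
      qed
      note * = this
      show "integrable lborel (\<lambda>x. indicator V x * (g b x * \<phi> x))"
        by (rule Bochner_Integration.integrable_bound[OF iw])
          (use * borel_measurable_indicator_mult[OF gm[OF b] \<phi>m(1)] in
            \<open>auto simp: w_def indicator_def intro!: AE_I2 order_trans[OF _ abs_ge_self] add_increasing2\<close>)
      show "integrable lborel (\<lambda>x. indicator V x * (u x * \<psi> x))"
        by (rule integrable_indicator_bounded[OF borel_measurable_indicator_mult[OF um \<phi>m(2)] bV, of M2])
          (use * in auto)
    qed
    have lim: "(\<lambda>n. \<integral>x. indicator V x * F n x \<partial>lborel)
        \<longlonglongrightarrow> (\<integral>x. indicator V x * (g b x * \<phi> x + u x * \<psi> x) \<partial>lborel)"
    proof (rule integral_dominated_convergence[where w=w, OF _ _ iw])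
      show "(\<lambda>x. indicator V x * (g b x * \<phi> x + u x * \<psi> x)) \<in> borel_measurable lborel"
        unfolding distrib_left measurable_lborel2
        by (intro borel_measurable_add borel_measurable_indicator_mult gm[OF b] um \<phi>m)
      show "(\<lambda>x. indicator V x * F n x) \<in> borel_measurable lborel" for n
        unfolding distrib_left F_def measurable_lborel2
        by (intro borel_measurable_add borel_measurable_indicator_mult gnm[OF b] mu \<phi>m)
      have "(\<lambda>n. F n x) \<longlonglongrightarrow> g b x * \<phi> x + u x * \<psi> x" if x: "x \<in> V" for x
      proof -
        have "(\<lambda>n. h x + e n) \<longlonglongrightarrow> h x"
          using tendsto_add[OF tendsto_const e0] by simp
        moreover have "h x \<in> {0..exp (- 2)}" "\<forall>n. h x + e n \<in> {0..exp (- 2)}"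
          using hV[OF x] by (auto simp: less_imp_le)
        ultimately have "(\<lambda>n. invlog (h x + e n)) \<longlonglongrightarrow> u x"
          unfolding u_def by (intro continuous_on_tendsto_compose[OF continuous_invlog]) auto
        then show ?thesis
          unfolding F_def by (intro tendsto_intros gn_lim[OF b x])
      qed
      then show "AE x in lborel. (\<lambda>n. indicator V x * F n x)
          \<longlonglongrightarrow> indicator V x * (g b x * \<phi> x + u x * \<psi> x)"
        by (intro AE_I2) (auto simp: indicator_def)
      show "AE x in lborel. norm (indicator V x * F n x) \<le> w x" for n
      proof (rule AE_I2)
        fix x
        show "norm (indicator V x * F n x) \<le> w x"
        proof (cases "x \<in> V")
          case True
          have "\<bar>gn b n x * \<phi> x\<bar> \<le> \<bar>g b x\<bar> * M1" "\<bar>invlog (h x + e n) * \<psi> x\<bar> \<le> 1 * M2"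
            unfolding abs_mult using M[OF True] un[OF True] gn_le[OF b True]
            by (intro mult_mono; simp)+
          then show ?thesis
            using True by (simp add: w_def F_def)
        qed (simp add: w_def)
      qed
    qed
    then have "(\<integral>x. indicator V x * (g b x * \<phi> x + u x * \<psi> x) \<partial>lborel) = 0"
      by (simp add: F0 LIMSEQ_const_iff)
    then have eq: "(\<integral>x. indicator V x * (u x * \<psi> x) \<partial>lborel) =
        - (\<integral>x. indicator V x * (g b x * \<phi> x) \<partial>lborel)"
      using i1 by (simp add: distrib_left)
    show ?thesis
      unfolding set_lebesgue_integral_def Gb[OF b] \<psi>_def[symmetric] real_scaleR_def
      using eq borel_measurable_integrable[OF i1(1)] borel_measurable_integrable[OF i1(2)]
      by (simp add: integral_completion)
  qed
  show ?thesis
    unfolding W12_loc_def has_weak_gradient_def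
    using L1 L2 weak by (auto simp: u_def)
qed

section \<open>Holomorphic functions on complex lines\<close>

lemma has_derivative_complex_line:
  fixes a v :: "complex ^ 'n"
  shows "((\<lambda>\<zeta>. a + \<zeta> *s v) has_derivative (\<lambda>\<zeta>. \<zeta> *s v)) (at \<zeta>)"
proof -
  have "linear (\<lambda>\<zeta>. \<zeta> *s v)"
    by (rule linearI) (simp_all add: vector_sadd_rdistrib vec_eq_iff)
  then have "bounded_linear (\<lambda>\<zeta>. \<zeta> *s v)"
    by (simp add: linear_conv_bounded_linear)
  then have "((\<lambda>\<zeta>. \<zeta> *s v) has_derivative (\<lambda>\<zeta>. \<zeta> *s v)) (at \<zeta>)"
    by (rule bounded_linear_imp_has_derivative)
  from has_derivative_add[OF has_derivative_const[of a] this] show ?thesis by simp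
qed

lemma open_complex_line:
  fixes a v :: "complex ^ 'n"
  assumes "open V"
  shows "open {\<zeta>. a + \<zeta> *s v \<in> V}"
proof -
  have "continuous_on UNIV (\<lambda>\<zeta>. a + \<zeta> *s v)"
    by (intro continuous_at_imp_continuous_on ballI)
      (rule has_derivative_continuous[OF has_derivative_complex_line])
  then show ?thesis
    using assms by (simp add: continuous_on_open_vimage[of UNIV] vimage_def)
qed

lemma convex_complex_line:
  fixes a v :: "complex ^ 'n"
  assumes "convex V"
  shows "convex {\<zeta>. a + \<zeta> *s v \<in> V}"
proof (rule convexI, unfold mem_Collect_eq)
  fix x y :: complex and s t :: real
  assume *: "a + x *s v \<in> V" "a + y *s v \<in> V" "0 \<le> s" "0 \<le> t" "s + t = 1"
  have "a + (s *\<^sub>R x + t *\<^sub>R y) *s v = (s + t) *\<^sub>R a + (s *\<^sub>R x + t *\<^sub>R y) *s v"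
    using *(5) by simp
  also have "\<dots> = s *\<^sub>R (a + x *s v) + t *\<^sub>R (a + y *s v)"
    by (simp add: vec_eq_iff algebra_simps)
  finally have "a + (s *\<^sub>R x + t *\<^sub>R y) *s v = s *\<^sub>R (a + x *s v) + t *\<^sub>R (a + y *s v)" .
  then show "a + (s *\<^sub>R x + t *\<^sub>R y) *s v \<in> V"
    using convexD[OF assms *] by simp
qed

lemma holomorphic_several_line:
  assumes "holomorphic_several f V"
  shows "(\<lambda>\<zeta>. f (a + \<zeta> *s v)) holomorphic_on {\<zeta>. a + \<zeta> *s v \<in> V}"
proof (rule holomorphic_onI)
  fix \<zeta> assume "\<zeta> \<in> {\<zeta>. a + \<zeta> *s v \<in> V}"
  then obtain D where D: "(f has_derivative D) (at (a + \<zeta> *s v))" "\<And>c v. D (c *s v) = c * D v"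
    using assms unfolding holomorphic_several_def by blast
  have "((\<lambda>\<zeta>. f (a + \<zeta> *s v)) has_derivative (\<lambda>\<zeta>. D (\<zeta> *s v))) (at \<zeta>)"
    using diff_chain_at[OF has_derivative_complex_line D(1)] by (simp add: o_def)
  then have "((\<lambda>\<zeta>. f (a + \<zeta> *s v)) has_field_derivative D v) (at \<zeta>)"
    unfolding has_field_derivative_def D(2) by (simp add: mult_commute_abs)
  then show "(\<lambda>\<zeta>. f (a + \<zeta> *s v)) field_differentiable at \<zeta> within {\<zeta>. a + \<zeta> *s v \<in> V}"
    using field_differentiable_at_within field_differentiable_def by blast
qed

lemma holomorphic_several_continuous_on:
  "holomorphic_several f V \<Longrightarrow> continuous_on V f"
  unfolding holomorphic_several_def
  by (meson continuous_at_imp_continuous_on has_derivative_continuous)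

lemma holomorphic_several_subset:
  "holomorphic_several f V \<Longrightarrow> U \<subseteq> V \<Longrightarrow> holomorphic_several f U"
  unfolding holomorphic_several_def by blast

text \<open>Join \<open>a\<close> to \<open>y\<close> by a complex line and apply the one-variable
  identity theorem on it. Convexity makes the slice of \<open>B\<close> connected; slices of a
  merely connected set can fall apart.\<close>

lemma holomorphic_several_eq_0_convex:
  fixes f :: "complex ^ 'n \<Rightarrow> complex"
  assumes f: "holomorphic_several f B" and B: "open B" "convex B"
    and U: "open U" "a \<in> U" "U \<subseteq> B" "\<And>x. x \<in> U \<Longrightarrow> f x = 0" and y: "y \<in> B"
  shows "f y = 0"
proof -
  define l where "l \<zeta> = a + \<zeta> *s (y - a)" for \<zeta>
  have "f (l 1) = 0"
  proof (rule analytic_continuation_open[of "{\<zeta>. l \<zeta> \<in> U}" "{\<zeta>. l \<zeta> \<in> B}" "\<lambda>\<zeta>. f (l \<zeta>)" "\<lambda>_. 0"])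
    show "open {\<zeta>. l \<zeta> \<in> U}" "open {\<zeta>. l \<zeta> \<in> B}"
      unfolding l_def by (rule open_complex_line, fact)+
    show "connected {\<zeta>. l \<zeta> \<in> B}"
      unfolding l_def by (intro convex_connected convex_complex_line B)
    show "{\<zeta>. l \<zeta> \<in> U} \<noteq> {}" using U(2) by (auto simp: l_def intro!: exI[of _ 0])
    show "(\<lambda>\<zeta>. f (l \<zeta>)) holomorphic_on {\<zeta>. l \<zeta> \<in> B}"
      unfolding l_def by (rule holomorphic_several_line[OF f])
  qed (use U y in \<open>auto simp: l_def\<close>)
  then show ?thesis by (simp add: l_def)
qed

text \<open>The interior \<open>S\<close> of the zero set is also closed in \<open>V\<close>: a ball
  in \<open>V\<close> that meets \<open>S\<close> lies in \<open>S\<close> by the convex case.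
  Connectedness then gives \<open>V \<subseteq> S\<close>.\<close>

lemma holomorphic_several_identity:
  fixes f :: "complex ^ 'n \<Rightarrow> complex"
  assumes f: "holomorphic_several f V" and V: "open V" "connected V"
    and U: "open U" "U \<noteq> {}" "U \<subseteq> V" "\<And>x. x \<in> U \<Longrightarrow> f x = 0" and z: "z \<in> V"
  shows "f z = 0"
proof -
  define S where "S = \<Union>{T. open T \<and> T \<subseteq> V \<and> (\<forall>x\<in>T. f x = 0)}"
  have oS: "open S" unfolding S_def by blast
  have "open (V - S)"
  proof (subst open_contains_ball, rule ballI)
    fix x assume x: "x \<in> V - S"
    then obtain r where r: "0 < r" "ball x r \<subseteq> V"
      using V(1) by (auto simp: open_contains_ball)
    have "ball x r \<inter> S = {}"
    proof (rule ccontr)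
      assume "ball x r \<inter> S \<noteq> {}"
      then obtain a where a: "a \<in> ball x r" "a \<in> S" by blast
      have "f y = 0" if "y \<in> ball x r" for y
        by (rule holomorphic_several_eq_0_convex[OF holomorphic_several_subset[OF f r(2)], of "S \<inter> ball x r" a])
          (use oS a that in \<open>auto simp: S_def\<close>)
      then have "ball x r \<subseteq> S" using r unfolding S_def by blast
      moreover have "x \<in> ball x r" using r(1) by simp
      ultimately show False using x by blast
    qed
    then show "\<exists>e>0. ball x e \<subseteq> V - S" using r by blast
  qed
  moreover have "U \<subseteq> S" unfolding S_def using U by blast
  then have "S \<inter> V \<noteq> {}" using U by blast
  ultimately have "(V - S) \<inter> V = {}"
    using connectedD[OF V(2) oS, of "V - S"] by blast
  then have "z \<in> S" using z by blast
  then show ?thesis by (auto simp: S_def)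
qed

text \<open>Defined by restriction to a complex line, so that iterating along the same
  \<open>v\<close> gives higher derivatives of one function of one variable, to which Cauchy's
  inequality applies.\<close>

definition line_deriv :: "complex ^ 'n \<Rightarrow> (complex ^ 'n \<Rightarrow> complex) \<Rightarrow> complex ^ 'n \<Rightarrow> complex" where
  "line_deriv v f x = deriv (\<lambda>\<zeta>. f (x + \<zeta> *s v)) 0"

lemma line_deriv_along:
  "line_deriv v f (x + \<zeta> *s v) = deriv (\<lambda>\<zeta>. f (x + \<zeta> *s v)) \<zeta>"
  unfolding line_deriv_def
  by (subst (2) deriv_shift_0) (simp add: o_def vector_sadd_rdistrib add.assoc)

lemma line_deriv_line_deriv:
  "line_deriv v (line_deriv v f) x = (deriv ^^ 2) (\<lambda>\<zeta>. f (x + \<zeta> *s v)) 0"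
  unfolding line_deriv_def[of v "line_deriv v f"] line_deriv_along by (simp add: numeral_2_eq_2)

lemma field_derivative_imp_real_line_derivative:
  fixes x v :: "complex ^ 'n"
  assumes "((\<lambda>\<zeta>. f (x + \<zeta> *s v)) has_field_derivative d) (at 0)"
  shows "((\<lambda>t. f (x + t *\<^sub>R v)) has_vector_derivative d) (at 0)"
proof -
  have eq: "x + t *\<^sub>R v = x + complex_of_real t *s v" for t
    unfolding vec_eq_iff vector_add_component vector_smult_component vector_scaleR_component
    by (simp add: scaleR_conv_of_real)
  show ?thesis
    unfolding eq
    using has_vector_derivative_real_field[of "\<lambda>\<zeta>. f (x + \<zeta> *s v)" d 0 UNIV] assms by simp
qed

lemma line_deriv_has_vector_derivative:
  fixes x v :: "complex ^ 'n"
  assumes f: "holomorphic_several f V" and V: "open V" and x: "x \<in> V"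
  shows "((\<lambda>t. f (x + t *\<^sub>R v)) has_vector_derivative line_deriv v f x) (at 0)"
    "((\<lambda>t. line_deriv v f (x + t *\<^sub>R v)) has_vector_derivative
        line_deriv v (line_deriv v f) x) (at 0)"
proof -
  let ?g = "\<lambda>\<zeta>. f (x + \<zeta> *s v)" and ?S = "{\<zeta>. x + \<zeta> *s v \<in> V}"
  have g: "?g holomorphic_on ?S" and S: "open ?S" "0 \<in> ?S"
    using holomorphic_several_line[OF f] open_complex_line[OF V] x by auto
  show "((\<lambda>t. f (x + t *\<^sub>R v)) has_vector_derivative line_deriv v f x) (at 0)"
    unfolding line_deriv_def
    by (rule field_derivative_imp_real_line_derivative) (rule holomorphic_derivI[OF g S])
  have "(deriv ?g has_field_derivative deriv (deriv ?g) 0) (at 0)"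
    by (rule holomorphic_derivI[OF holomorphic_deriv[OF g S(1)] S])
  then have "((\<lambda>\<zeta>. line_deriv v f (x + \<zeta> *s v)) has_field_derivative
      line_deriv v (line_deriv v f) x) (at 0)"
    by (simp add: line_deriv_along line_deriv_line_deriv numeral_2_eq_2)
  then show "((\<lambda>t. line_deriv v f (x + t *\<^sub>R v)) has_vector_derivative
        line_deriv v (line_deriv v f) x) (at 0)"
    by (rule field_derivative_imp_real_line_derivative)
qed

text \<open>Cauchy's inequality on the parameter disc of radius \<open>d / 2\<close>: halving keeps
  the closed disc inside \<open>V\<close>, and the condition on \<open>v\<close> identifies
  parameter distance with distance in space.\<close>

lemma line_deriv_bounds:
  fixes x v :: "complex ^ 'n"
  assumes f: "holomorphic_several f V" and d: "0 < d" "ball x d \<subseteq> V"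
    and v: "\<And>\<zeta>. norm (\<zeta> *s v) = norm \<zeta>" and M: "\<And>y. y \<in> V \<Longrightarrow> norm (f y) \<le> M"
  shows "norm (line_deriv v f x) \<le> M / (d / 2)"
    "norm (line_deriv v (line_deriv v f) x) \<le> 2 * M / (d / 2)\<^sup>2"
proof -
  let ?g = "\<lambda>\<zeta>. f (x + \<zeta> *s v)"
  have sub: "cball 0 (d / 2) \<subseteq> {\<zeta>. x + \<zeta> *s v \<in> V}"
  proof safe
    fix \<zeta> :: complex assume "\<zeta> \<in> cball 0 (d / 2)"
    then have "x + \<zeta> *s v \<in> ball x d" using v[of \<zeta>] d(1) by (simp add: dist_norm)
    then show "x + \<zeta> *s v \<in> V" using d(2) by blast
  qed
  have hol: "?g holomorphic_on cball 0 (d / 2)"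
    by (rule holomorphic_on_subset[OF holomorphic_several_line[OF f] sub])
  have "norm ((deriv ^^ n) ?g 0) \<le> fact n * M / (d / 2) ^ n" for n
  proof (rule Cauchy_inequality)
    show "?g holomorphic_on ball 0 (d / 2)" by (rule holomorphic_on_subset[OF hol ball_subset_cball])
    show "continuous_on (cball 0 (d / 2)) ?g" by (rule holomorphic_on_imp_continuous_on[OF hol])
    show "norm (f (x + \<zeta> *s v)) \<le> M" if "norm (0 - \<zeta>) = d / 2" for \<zeta>
      using sub that by (intro M) auto
  qed (use d in simp)
  from this[of 1] this[of 2] show "norm (line_deriv v f x) \<le> M / (d / 2)"
    "norm (line_deriv v (line_deriv v f) x) \<le> 2 * M / (d / 2)\<^sup>2"
    by (simp_all add: line_deriv_line_deriv) (simp add: line_deriv_def)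
qed

text \<open>Applied with \<open>c = \<i>\<close>, where \<open>c\<^sup>2 = - 1\<close> makes second
  derivatives along \<open>v\<close> and \<open>\<i> *s v\<close> opposite.\<close>

lemma line_deriv_scale:
  fixes x v :: "complex ^ 'n"
  assumes f: "holomorphic_several f V" and V: "open V" and x: "x \<in> V"
  shows "line_deriv (c *s v) f x = c * line_deriv v f x"
    "line_deriv (c *s v) (line_deriv (c *s v) f) x = c\<^sup>2 * line_deriv v (line_deriv v f) x"
proof -
  let ?g = "\<lambda>\<zeta>. f (x + \<zeta> *s v)" and ?S = "{\<zeta>. x + \<zeta> *s v \<in> V}"
  have eq: "(\<lambda>\<zeta>. f (x + \<zeta> *s (c *s v))) = (\<lambda>\<zeta>. ?g (c * \<zeta>))"
    by (simp add: vector_smult_assoc mult.commute)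
  have *: "(deriv ^^ n) (\<lambda>\<zeta>. ?g (c * \<zeta>)) 0 = c ^ n * (deriv ^^ n) ?g (c * 0)" for n
  proof (rule higher_deriv_compose_linear[where S="{\<zeta>. x + \<zeta> *s (c *s v) \<in> V}" and T="?S"])
    show "?g holomorphic_on ?S" by (rule holomorphic_several_line[OF f])
    show "open {\<zeta>. x + \<zeta> *s (c *s v) \<in> V}" "open ?S"
      by (rule open_complex_line[OF V])+
  qed (use x in \<open>simp_all add: vector_smult_assoc mult.commute\<close>)
  show "line_deriv (c *s v) f x = c * line_deriv v f x"
    using *[of 1] unfolding line_deriv_def eq by simp
  show "line_deriv (c *s v) (line_deriv (c *s v) f) x = c\<^sup>2 * line_deriv v (line_deriv v f) x"
    using *[of 2] by (simp only: line_deriv_line_deriv eq) simp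
qed


lemma norm_square_has_dir_derivative:
  fixes f :: "complex ^ 'n \<Rightarrow> complex"
  assumes f: "holomorphic_several f V" and V: "open V" and x: "x \<in> V"
  shows "has_dir_derivative (\<lambda>x. (norm (f x))\<^sup>2) v x (2 * (f x \<bullet> line_deriv v f x))"
    "has_dir_derivative (\<lambda>x. 2 * (f x \<bullet> line_deriv v f x)) v x
      (2 * (f x \<bullet> line_deriv v (line_deriv v f) x + (norm (line_deriv v f x))\<^sup>2))"
proof -
  note d = line_deriv_has_vector_derivative[OF f V x, of v]
  note * = bounded_bilinear.has_vector_derivative[OF bounded_bilinear_inner d(1) d(1)]
  show "has_dir_derivative (\<lambda>x. (norm (f x))\<^sup>2) v x (2 * (f x \<bullet> line_deriv v f x))"
    unfolding has_dir_derivative_def has_real_derivative_iff_has_vector_derivative power2_norm_eq_inner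
    using * by (simp add: inner_commute)
  note * = bounded_bilinear.has_vector_derivative[OF bounded_bilinear_inner d(1) d(2)]
  have "((\<lambda>t. f (x + t *\<^sub>R v) \<bullet> line_deriv v f (x + t *\<^sub>R v)) has_real_derivative
      f x \<bullet> line_deriv v (line_deriv v f) x + (norm (line_deriv v f x))\<^sup>2) (at 0)"
    unfolding has_real_derivative_iff_has_vector_derivative power2_norm_eq_inner
    using * by simp
  then show "has_dir_derivative (\<lambda>x. 2 * (f x \<bullet> line_deriv v f x)) v x
      (2 * (f x \<bullet> line_deriv v (line_deriv v f) x + (norm (line_deriv v f x))\<^sup>2))"
    unfolding has_dir_derivative_def by (rule DERIV_cmult)
qed

text \<open>With \<open>S = (\<Sum>i\<in>I. cnj (a i) * b i)\<close> the left-hand side is \<open>4 \<bar>S\<bar>\<^sup>2\<close>. It is the squared gradient of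
  \<open>\<Sum>\<bar>f i\<bar>\<^sup>2\<close> in one complex direction, where the Laplacian is \<open>4 * (\<Sum>\<bar>f i'\<bar>\<^sup>2)\<close>.\<close>

lemma hermitian_Cauchy_Schwarz:
  fixes a b :: "'i \<Rightarrow> complex"
  shows "(\<Sum>i\<in>I. 2 * (a i \<bullet> b i))\<^sup>2 + (\<Sum>i\<in>I. 2 * (a i \<bullet> (\<i> * b i)))\<^sup>2
    \<le> (\<Sum>i\<in>I. (norm (a i))\<^sup>2) * (4 * (\<Sum>i\<in>I. (norm (b i))\<^sup>2))"
proof -
  define S where "S = (\<Sum>i\<in>I. cnj (a i) * b i)"
  have "(\<Sum>i\<in>I. a i \<bullet> b i) = Re S" "(\<Sum>i\<in>I. a i \<bullet> (\<i> * b i)) = - Im S"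
    unfolding S_def by (simp_all add: inner_complex_def sum_negf[symmetric])
  then have "(\<Sum>i\<in>I. 2 * (a i \<bullet> b i))\<^sup>2 + (\<Sum>i\<in>I. 2 * (a i \<bullet> (\<i> * b i)))\<^sup>2 = 4 * (norm S)\<^sup>2"
    by (simp add: sum_distrib_left[symmetric] power_mult_distrib cmod_power2)
  moreover have "norm S \<le> (\<Sum>i\<in>I. norm (a i) * norm (b i))"
    unfolding S_def by (rule order_trans[OF norm_sum]) (simp add: norm_mult)
  then have "(norm S)\<^sup>2 \<le> (\<Sum>i\<in>I. norm (a i) * norm (b i))\<^sup>2"
    by (rule power_mono) simp
  also have "\<dots> \<le> (\<Sum>i\<in>I. (norm (a i))\<^sup>2) * (\<Sum>i\<in>I. (norm (b i))\<^sup>2)"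
    by (rule Cauchy_Schwarz_ineq_sum)
  ultimately show ?thesis by simp
qed

text \<open>The zero order \<open>n\<close> of a restriction to a complex line through \<open>x\<close> is finite, so along that line
  \<open>invlog h\<close> is at least of order \<open>1 / \<bar>ln t\<bar>\<close>; but at the minimum point \<open>x\<close> a derivative
  would have to vanish.\<close>

lemma not_differentiable_invlog:
  fixes h :: "complex ^ 'n \<Rightarrow> real" and f :: "complex ^ 'n \<Rightarrow> complex"
  assumes W: "open W" "convex W" and x: "x \<in> W" "h x = 0"
    and h: "\<And>y. y \<in> W \<Longrightarrow> h y \<le> exp (- 3)" "\<And>y. y \<in> W \<Longrightarrow> (norm (f y))\<^sup>2 \<le> h y"
    and f: "holomorphic_several f W" and z: "z \<in> W" "f z \<noteq> 0"
  shows "\<not> (\<lambda>y. invlog (h y)) differentiable (at x)"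
proof
  assume "(\<lambda>y. invlog (h y)) differentiable (at x)"
  then obtain D where D: "((\<lambda>y. invlog (h y)) has_derivative D) (at x)"
    by (auto simp: differentiable_def)
  have h0: "0 \<le> h y" "h y \<le> exp (- 2)" if "y \<in> W" for y
    using h[OF that] zero_le_power2[of "norm (f y)"] two_exp_m3 exp_gt_zero[of "- 3 :: real"] by linarith+
  have "D = (\<lambda>v. 0)"
    by (rule differential_zero_maxmin[OF x(1) W(1) D]) (use x(2) h0 invlog_bounds in auto)
  then have "has_dir_derivative (\<lambda>y. invlog (h y)) (z - x) x 0"
    using has_derivative_imp_has_dir_derivative[OF D, of "z - x"] by simp
  then have "((\<lambda>t. invlog (h (x + t *\<^sub>R (z - x))) / t) \<longlongrightarrow> 0) (at 0)"
    unfolding has_dir_derivative_def DERIV_def using x(2) by simp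
  then have lim0: "((\<lambda>t. invlog (h (x + t *\<^sub>R (z - x))) / t) \<longlongrightarrow> 0) (at_right 0)"
    by (rule filterlim_mono) (auto intro: at_le)
  define S where "S = {\<zeta>. x + \<zeta> *s (z - x) \<in> W}"
  define g where "g \<zeta> = f (x + \<zeta> *s (z - x))" for \<zeta>
  have g: "g holomorphic_on S" "open S" "connected S" "0 \<in> S" "1 \<in> S"
    unfolding S_def g_def[abs_def] using x(1) z(1)
    by (auto intro!: holomorphic_several_line[OF f] open_complex_line W convex_connected
        convex_complex_line simp del: vector_ssub_ldistrib)
  \<comment> \<open>The direction \<open>z - x\<close> puts \<open>x\<close> at parameter
    \<open>0\<close> and \<open>z\<close> at parameter \<open>1\<close>, so the restriction
    \<open>g\<close> is not constant and its zero at \<open>0\<close> has finite order.\<close>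
  have g01: "g 0 = 0" "g 1 \<noteq> 0"
    using h(2)[OF x(1)] x(2) z(2) by (auto simp: g_def)
  then have "\<not> g constant_on S"
    using g(4,5) unfolding constant_on_def by metis
  then obtain k \<rho> n where n: "0 < n" and k: "0 < \<rho>" "ball 0 \<rho> \<subseteq> S" "k holomorphic_on ball 0 \<rho>"
      "\<And>w. w \<in> ball 0 \<rho> \<Longrightarrow> g w = (w - 0) ^ n * k w" "\<And>w. w \<in> ball 0 \<rho> \<Longrightarrow> k w \<noteq> 0"
    by (rule holomorphic_factor_zero_nonconstant[OF g(1-4) g01(1)]) (rule that; assumption)
  define \<kappa> where "\<kappa> = norm (k 0) / 2"
  have \<kappa>: "0 < \<kappa>" "\<kappa> < norm (k 0)" using k(1) k(5)[of 0] by (auto simp: \<kappa>_def)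
  have "isCont k 0"
    using holomorphic_on_imp_continuous_on[OF k(3)] k(1) by (simp add: continuous_on_eq_continuous_at)
  then have "((\<lambda>t. norm (k (complex_of_real t))) \<longlongrightarrow> norm (k (complex_of_real 0))) (at_right 0)"
    by (intro tendsto_norm isCont_tendsto_compose[of _ k] tendsto_of_real tendsto_ident_at) simp
  then have ev1: "\<forall>\<^sub>F t in at_right 0. \<kappa> < norm (k (complex_of_real t))"
    using \<kappa>(2) by (intro order_tendstoD(1)) auto
  have ev2: "\<forall>\<^sub>F t in at_right 0. t < \<rho>" "\<forall>\<^sub>F t in at_right 0. (0::real) < t"
    using k(1) by (auto simp: eventually_at_right_less intro: eventually_at_right_real order_tendstoD)
  \<comment> \<open>The left-hand side is \<open>invlog ((\<kappa> * t ^ n)\<^sup>2) / t\<close>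
    written out: \<open>h\<close> is at least \<open>(\<kappa> * t ^ n)\<^sup>2\<close> along the
    line, and \<open>invlog\<close> is increasing.\<close>
  have "\<forall>\<^sub>F t in at_right 0. - 1 / (t * (2 * ln \<kappa> + 2 * real n * ln t))
      \<le> invlog (h (x + t *\<^sub>R (z - x))) / t"
    using ev1 ev2
  proof eventually_elim
    case (elim t)
    have t: "complex_of_real t \<in> ball 0 \<rho>" using elim by simp
    define y where "y = x + t *\<^sub>R (z - x)"
    have y: "y = x + complex_of_real t *s (z - x)"
      unfolding y_def vec_eq_iff vector_add_component vector_smult_component vector_scaleR_component
      by (simp add: scaleR_conv_of_real)
    have "complex_of_real t \<in> S" using t k(2) by blast
    then have yW: "y \<in> W" unfolding S_def y by (rule CollectD)
    have pos: "0 < (\<kappa> * t ^ n)\<^sup>2" using \<kappa>(1) elim by simp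
    have "\<kappa> * t ^ n \<le> norm (g t)"
      using k(4)[OF t] elim by (simp add: norm_mult norm_power mult.commute mult_left_mono)
    then have "(\<kappa> * t ^ n)\<^sup>2 \<le> (norm (f y))\<^sup>2"
      using \<kappa>(1) elim by (intro power_mono) (auto simp: g_def y)
    also have "\<dots> \<le> h y" by (rule h(2)[OF yW])
    finally have "invlog ((\<kappa> * t ^ n)\<^sup>2) \<le> invlog (h y)"
      using pos h0[OF yW] by (intro invlog_mono)
    moreover have "ln ((\<kappa> * t ^ n)\<^sup>2) = 2 * ln \<kappa> + 2 * real n * ln t"
      using \<kappa>(1) elim by (simp add: ln_realpow ln_mult)
    ultimately have "- 1 / (2 * ln \<kappa> + 2 * real n * ln t) / t \<le> invlog (h y) / t"
      using elim by (intro divide_right_mono) (auto simp: invlog_def)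
    then show ?case by (simp add: y_def mult.commute)
  qed
  \<comment> \<open>The denominator tends to \<open>0\<close> from below, because
    \<open>t * ln t\<close> does and \<open>n\<close> is positive.\<close>
  moreover have "filterlim (\<lambda>t. - 1 / (t * (2 * ln \<kappa> + 2 * real n * ln t))) at_top (at_right 0)"
  proof -
    have "0 < real n" using n by simp
    then show ?thesis by real_asymp
  qed
  ultimately have "filterlim (\<lambda>t. invlog (h (x + t *\<^sub>R (z - x))) / t) at_top (at_right 0)"
    by (rule filterlim_at_top_mono[rotated])
  then show False
    using lim0 not_tendsto_and_filterlim_at_infinity[of "at_right (0::real)"]
      filterlim_at_top_imp_at_infinity by fastforce
qed

section \<open>Sums of squared moduli\<close>

definition norm_squares :: "(complex ^ 'n \<Rightarrow> complex) set \<Rightarrow> complex ^ 'n \<Rightarrow> real" where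
  "norm_squares F x = (\<Sum>f\<in>F. (norm (f x))\<^sup>2)"

definition norm_squares' ::
    "(complex ^ 'n \<Rightarrow> complex) set \<Rightarrow> complex ^ 'n \<Rightarrow> complex ^ 'n \<Rightarrow> real" where
  "norm_squares' F v x = (\<Sum>f\<in>F. 2 * (f x \<bullet> line_deriv v f x))"

definition norm_squares'' ::
    "(complex ^ 'n \<Rightarrow> complex) set \<Rightarrow> complex ^ 'n \<Rightarrow> complex ^ 'n \<Rightarrow> real" where
  "norm_squares'' F v x =
     (\<Sum>f\<in>F. 2 * (f x \<bullet> line_deriv v (line_deriv v f) x + (norm (line_deriv v f x))\<^sup>2))"

lemma norm_squares_nonneg: "0 \<le> norm_squares F x"
  by (simp add: norm_squares_def sum_nonneg)

lemma norm_squares_eq_0_iff: "finite F \<Longrightarrow> norm_squares F x = 0 \<longleftrightarrow> (\<forall>f\<in>F. f x = 0)"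
  by (simp add: norm_squares_def sum_nonneg_eq_0_iff)

lemma norm_square_le_norm_squares: "finite F \<Longrightarrow> f \<in> F \<Longrightarrow> (norm (f x))\<^sup>2 \<le> norm_squares F x"
  unfolding norm_squares_def by (rule member_le_sum) auto

lemma norm_squares_has_dir_derivative:
  assumes "\<And>f. f \<in> F \<Longrightarrow> holomorphic_several f V" "open V" "x \<in> V"
  shows "has_dir_derivative (norm_squares F) v x (norm_squares' F v x)"
    "has_dir_derivative (norm_squares' F v) v x (norm_squares'' F v x)"
  unfolding norm_squares_def[abs_def] norm_squares'_def[abs_def] norm_squares''_def
  by (rule has_dir_derivative_sum, erule norm_square_has_dir_derivative[OF assms(1) assms(2,3)])+

text \<open>Directional derivatives alone do not give classical differentiability off the zero set;
  it comes from the total derivative in \<open>holomorphic_several\<close>.\<close>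

lemma norm_squares_differentiable:
  assumes "\<And>f. f \<in> F \<Longrightarrow> holomorphic_several f V" "x \<in> V" "finite F"
  shows "norm_squares F differentiable (at x)"
proof -
  have "(\<lambda>x. (norm (f x))\<^sup>2) differentiable (at x)" if "f \<in> F" for f
  proof -
    have "f differentiable (at x)"
      using assms(1)[OF that] assms(2) unfolding holomorphic_several_def differentiable_def by blast
    then show ?thesis
      unfolding power2_norm_eq_inner by (rule differentiable_inner[OF _ \<open>f differentiable (at x)\<close>])
  qed
  then show ?thesis
    unfolding norm_squares_def[abs_def] using assms(3) by (intro differentiable_sum) auto
qed

text \<open>In the sum over \<open>v\<close> and \<open>\<i> *s v\<close> the terms with second
  derivatives of \<open>f\<close> cancel, and only squared first derivatives remain. The
  Cauchy-Schwarz inequality then yields the subharmonicity of the logarithm in multiplied-out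
  form.\<close>

lemma norm_squares_laplacian:
  assumes F: "\<And>f. f \<in> F \<Longrightarrow> holomorphic_several f V" and V: "open V" "x \<in> V"
  shows "norm_squares'' F v x + norm_squares'' F (\<i> *s v) x =
      4 * (\<Sum>f\<in>F. (norm (line_deriv v f x))\<^sup>2)"
    "(norm_squares' F v x)\<^sup>2 + (norm_squares' F (\<i> *s v) x)\<^sup>2 \<le>
      norm_squares F x * (norm_squares'' F v x + norm_squares'' F (\<i> *s v) x)"
proof -
  have s: "line_deriv (\<i> *s v) f x = \<i> * line_deriv v f x"
    "line_deriv (\<i> *s v) (line_deriv (\<i> *s v) f) x = - line_deriv v (line_deriv v f) x" if "f \<in> F" for f
    using line_deriv_scale[OF F[OF that] V, of \<i> v] by simp_all
  show 1: "norm_squares'' F v x + norm_squares'' F (\<i> *s v) x =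
      4 * (\<Sum>f\<in>F. (norm (line_deriv v f x))\<^sup>2)"
    unfolding norm_squares''_def sum.distrib[symmetric] sum_distrib_left
    by (intro sum.cong) (simp_all add: s norm_mult)
  have 2: "norm_squares' F (\<i> *s v) x = (\<Sum>f\<in>F. 2 * (f x \<bullet> (\<i> * line_deriv v f x)))"
    unfolding norm_squares'_def by (intro sum.cong) (simp_all add: s)
  show "(norm_squares' F v x)\<^sup>2 + (norm_squares' F (\<i> *s v) x)\<^sup>2 \<le>
      norm_squares F x * (norm_squares'' F v x + norm_squares'' F (\<i> *s v) x)"
    unfolding 1 2 unfolding norm_squares'_def norm_squares_def by (rule hermitian_Cauchy_Schwarz)
qed

text \<open>Each point of \<open>ball p R\<close> is the centre of a ball of radius \<open>R\<close>
  inside \<open>ball p (2 * R)\<close>, so the Cauchy bounds are uniform. Basis vectors are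
  \<open>axis j c\<close> with \<open>norm c = 1\<close>, hence meet the norm condition for these
  bounds.\<close>

lemma bounded_norm_squares_derivatives:
  fixes b :: "complex ^ 'n"
  assumes F: "finite F" "\<And>f. f \<in> F \<Longrightarrow> holomorphic_several f (ball p (2 * R))"
    and R: "0 < R" and b: "b \<in> Basis"
    and M: "\<And>f y. f \<in> F \<Longrightarrow> y \<in> ball p (2 * R) \<Longrightarrow> norm (f y) \<le> M"
  shows "bounded (norm_squares' F b ` ball p R)" "bounded (norm_squares'' F b ` ball p R)"
proof -
  obtain j c where "b = axis j c" "c \<in> Basis" using b by (auto simp: Basis_vec_def)
  then have "\<zeta> *s b = axis j (\<zeta> * c)" "norm c = 1" for \<zeta>
    by (auto simp: vec_eq_iff axis_def)
  moreover have "norm (axis j w :: complex ^ 'n) = norm w" for w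
    by (simp add: norm_eq_sqrt_inner inner_axis_axis)
  ultimately have nb: "norm (\<zeta> *s b) = norm \<zeta>" for \<zeta> by (simp add: norm_mult)
  have sub: "ball x R \<subseteq> ball p (2 * R)" if "x \<in> ball p R" for x
  proof
    fix y assume "y \<in> ball x R"
    then show "y \<in> ball p (2 * R)" using that dist_triangle[of p y x] by simp
  qed
  have "norm (f x) \<le> M" "norm (line_deriv b f x) \<le> M / (R / 2)"
    "norm (line_deriv b (line_deriv b f) x) \<le> 2 * M / (R / 2)\<^sup>2"
    if "f \<in> F" "x \<in> ball p R" for f x
  proof -
    have "x \<in> ball p (2 * R)" using that(2) R by simp
    then show "norm (f x) \<le> M" by (rule M[OF that(1)])
  qed (rule line_deriv_bounds[OF F(2)[OF that(1)] R sub[OF that(2)] nb M[OF that(1)]]; assumption)+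
  then have bd: "bounded ((\<lambda>x. f x) ` ball p R)" "bounded (line_deriv b f ` ball p R)"
    "bounded (line_deriv b (line_deriv b f) ` ball p R)" if "f \<in> F" for f
    using that unfolding bounded_iff by blast+
  have binner: "bounded ((\<lambda>x. f x \<bullet> g x) ` ball p R)"
    if fg: "bounded (f ` ball p R)" "bounded (g ` ball p R)" for f g :: "complex ^ 'n \<Rightarrow> complex"
  proof -
    obtain a where a: "\<forall>x\<in>ball p R. norm (f x) \<le> a"
      using fg(1) by (auto simp: bounded_iff)
    obtain c where c: "\<forall>x\<in>ball p R. norm (g x) \<le> c"
      using fg(2) by (auto simp: bounded_iff)
    have "norm (f x \<bullet> g x) \<le> a * c" if "x \<in> ball p R" for x
    proof -
      have "\<bar>f x \<bullet> g x\<bar> \<le> norm (f x) * norm (g x)" by (rule Cauchy_Schwarz_ineq2)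
      also have "\<dots> \<le> a * c" using a c that by (intro mult_mono') auto
      finally show ?thesis by simp
    qed
    then show ?thesis unfolding bounded_iff by blast
  qed
  have bsum: "bounded ((\<lambda>x. \<Sum>f\<in>F. g f x) ` ball p R)"
    if "\<And>f. f \<in> F \<Longrightarrow> bounded (g f ` ball p R)" for g :: "_ \<Rightarrow> complex ^ 'n \<Rightarrow> real"
    using F(1) that
  proof (induction F rule: finite_induct)
    case empty
    then show ?case by (auto simp: bounded_iff)
  next
    case (insert f F)
    then show ?case by (auto intro!: bounded_plus_comp)
  qed
  have const: "bounded ((\<lambda>x. c) ` ball p R)" for c :: real by (auto simp: bounded_iff)
  show "bounded (norm_squares' F b ` ball p R)" "bounded (norm_squares'' F b ` ball p R)"
    unfolding norm_squares'_def[abs_def] norm_squares''_def[abs_def] power2_norm_eq_inner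
    by (intro bsum bounded_image_mult bounded_plus_comp binner const bd; assumption)+
qed

section \<open>Local construction around a point of the analytic set\<close>

theorem corollary1p4:
  fixes A :: "(complex ^ 'n) set" and p :: "complex ^ 'n"
  assumes "complex_analytic_set A"
    and "p \<in> A"
  shows "\<exists>(V :: (complex ^ 'n) set) (u :: complex ^ 'n \<Rightarrow> real).
           open V \<and> p \<in> V \<and> continuous_on V u \<and> W12_loc V u \<and>
           removable_gradient_singularities V u = A \<inter> V \<and>
           (\<forall>x\<in>V - A. u differentiable (at x)) \<and>
           (\<forall>x\<in>A \<inter> V. \<not> u differentiable (at x))"
proof -
  obtain V0 F where V0: "open V0" "connected V0" "p \<in> V0"
    and F: "finite F" "\<And>f. f \<in> F \<Longrightarrow> holomorphic_several f V0"
    and nz: "\<exists>f\<in>F. \<exists>z\<in>V0. f z \<noteq> 0"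
    and A: "A \<inter> V0 = {z \<in> V0. \<forall>f\<in>F. f z = 0}"
    using bspec[OF assms(1)[unfolded complex_analytic_set_def] assms(2)] by blast
  define h where "h = norm_squares F"
  have h0: "h x = 0 \<longleftrightarrow> x \<in> A" if "x \<in> V0" for x
    using A that norm_squares_eq_0_iff[OF F(1)] unfolding h_def by blast
  have hc: "continuous_on V0 h"
    unfolding h_def norm_squares_def[abs_def]
    by (intro continuous_intros holomorphic_several_continuous_on F)
  have "open {x \<in> V0. h x < exp (- 3)}"
  proof -
    have "{x \<in> V0. h x < exp (- 3)} = V0 \<inter> h -` {..<exp (- 3)}" by auto
    then show ?thesis using continuous_open_preimage[OF hc V0(1), of "{..<exp (- 3)}"] by simp
  qed
  moreover have "p \<in> {x \<in> V0. h x < exp (- 3)}" using h0[OF V0(3)] assms(2) V0(3) by simp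
  ultimately obtain R0 where R0: "0 < R0" "ball p R0 \<subseteq> {x \<in> V0. h x < exp (- 3)}"
    by (meson open_contains_ball)
  \<comment> \<open>Three concentric balls: the functions are bounded on radius
    \<open>2 * R\<close>, hence their derivatives on radius \<open>R\<close>, and the cutoff
    argument bounds the energy on radius \<open>r\<close>.\<close>
  define R where "R = R0 / 2"
  define r where "r = R / 2"
  have R: "0 < R" "R0 = 2 * R" "0 < r" "r < R" using R0(1) by (auto simp: R_def r_def)
  have b2: "x \<in> V0" "h x \<le> exp (- 3)" if "x \<in> ball p (2 * R)" for x
    using R0(2) R(2) that by auto
  have WV0: "ball p R \<subseteq> ball p (2 * R)" "ball p r \<subseteq> ball p R" using R by auto
  have Fhol: "holomorphic_several f (ball p (2 * R))" if "f \<in> F" for f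
    by (rule holomorphic_several_subset[OF F(2)[OF that]]) (use b2 in blast)
  have f_le_1: "norm (f y) \<le> 1" if "f \<in> F" "y \<in> ball p (2 * R)" for f y
  proof -
    have "(norm (f y))\<^sup>2 \<le> exp (- 3)"
      using norm_square_le_norm_squares[OF F(1) that(1), of y] b2(2)[OF that(2)] by (simp add: h_def)
    also have "\<dots> \<le> 1\<^sup>2" by simp
    finally show ?thesis by (rule power2_le_imp_le) simp
  qed
  define V where "V = ball p r"
  define u where "u = (\<lambda>x. invlog (h x))"
  have V: "open V" "p \<in> V" "V \<subseteq> ball p R" "V \<subseteq> V0" using R WV0 b2 by (auto simp: V_def)
  have hV: "h x \<in> {0..exp (- 2)}" if "x \<in> V" for x
    using b2(2)[of x] that V(3) WV0(1) two_exp_m3 exp_gt_zero[of "- 3 :: real"] norm_squares_nonneg[of F x]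
    by (auto simp: h_def subset_iff)
  have uc: "continuous_on V u"
    unfolding u_def using hV V(4)
    by (intro continuous_on_compose2[OF continuous_invlog continuous_on_subset[OF hc]]) auto
  have W12: "W12_loc V u"
    unfolding u_def
  proof (rule W12_loc_invlog[OF refl V_def R(3,4)])
    show "continuous_on (ball p R) h"
      by (rule continuous_on_subset[OF hc]) (use b2 WV0 in blast)
    show "0 \<le> h x" for x by (simp add: h_def norm_squares_nonneg)
    show "h x \<le> exp (- 3)" if "x \<in> ball p R" for x using b2(2) that WV0(1) by blast
    fix b :: "complex ^ 'n" assume b: "b \<in> Basis"
    show "bounded (norm_squares' F b ` ball p R)" "bounded (norm_squares'' F b ` ball p R)"
      using bounded_norm_squares_derivatives[of F p R b 1] F(1) Fhol R(1) b f_le_1 by blast+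
    show "has_dir_derivative h b x (norm_squares' F b x)"
      "has_dir_derivative (norm_squares' F b) b x (norm_squares'' F b x)" if "x \<in> ball p R" for x
      unfolding h_def using norm_squares_has_dir_derivative[OF Fhol open_ball, of F x b] that WV0(1) by auto
    have pair: "0 \<le> norm_squares'' F v x + norm_squares'' F (\<i> *s v) x \<and>
        (norm_squares' F v x)\<^sup>2 + (norm_squares' F (\<i> *s v) x)\<^sup>2
          \<le> h x * (norm_squares'' F v x + norm_squares'' F (\<i> *s v) x)"
      if "x \<in> ball p R" for v x
    proof -
      have "x \<in> ball p (2 * R)" using that WV0(1) by blast
      from norm_squares_laplacian[OF Fhol open_ball this, of F v] show ?thesis
        by (simp add: h_def sum_nonneg)
    qed
    obtain j c where bc: "b = axis j c" "c = 1 \<or> c = \<i>"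
      using b by (auto simp: Basis_vec_def Basis_complex_def)
    \<comment> \<open>The partner of a real basis vector is the other real direction of the same
      complex coordinate; the inequality is symmetric in the two, so one pair covers both
      cases.\<close>
    define e where "e = (axis j 1 :: complex ^ 'n)"
    have ie: "\<i> *s e = axis j \<i>" by (auto simp: vec_eq_iff axis_def e_def)
    have eB: "e \<in> Basis" "\<i> *s e \<in> Basis" by (simp_all add: ie) (simp_all add: e_def Basis_complex_def)
    show "\<exists>c\<in>Basis. \<forall>x\<in>ball p R. 0 \<le> norm_squares'' F b x + norm_squares'' F c x \<and>
        (norm_squares' F b x)\<^sup>2 + (norm_squares' F c x)\<^sup>2
          \<le> h x * (norm_squares'' F b x + norm_squares'' F c x)"
    proof (cases "c = 1")
      case True
      then have "b = e" using bc by (simp add: e_def)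
      then show ?thesis using pair[of _ e] eB by blast
    next
      case False
      then have "b = \<i> *s e" using bc by (simp add: ie)
      then show ?thesis using pair[of _ e] eB by (auto simp: add.commute intro!: bexI[of _ e])
    qed
  qed
  have nd: "\<not> u differentiable (at x)" if x: "x \<in> A" "x \<in> V" for x
  proof -
    obtain f z where f: "f \<in> F" "z \<in> V0" "f z \<noteq> 0" using nz by blast
    \<comment> \<open>The point \<open>z\<close> may lie far from \<open>V\<close>. Connectedness of
      \<open>V0\<close> and the identity theorem provide a nonzero value inside the convex set
      \<open>V\<close>, where lines can be drawn.\<close>
    have "\<exists>w\<in>V. f w \<noteq> 0"
      using holomorphic_several_identity[OF F(2)[OF f(1)] V0(1,2) V(1) _ V(4) _ f(2)] V(2) f(3) by blast
    then obtain w where w: "w \<in> V" "f w \<noteq> 0" by blast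
    show ?thesis
      unfolding u_def
    proof (rule not_differentiable_invlog[where W=V and f=f and z=w])
      show "open V" "x \<in> V" "w \<in> V" "f w \<noteq> 0" by fact+
      show "convex V" by (simp add: V_def)
      show "h x = 0" using h0 x V(4) by blast
      show "h y \<le> exp (- 3)" if "y \<in> V" for y using b2(2) that V(3) WV0(1) by blast
      show "(norm (f y))\<^sup>2 \<le> h y" for y
        unfolding h_def by (rule norm_square_le_norm_squares[OF F(1) f(1)])
      show "holomorphic_several f V" by (rule holomorphic_several_subset[OF F(2)[OF f(1)] V(4)])
    qed
  qed
  have df: "u differentiable (at x)" if x: "x \<in> V" "x \<notin> A" for x
  proof -
    have "0 < h x" using h0[of x] x V(4) hV[of x] by (auto simp: less_le)
    then have "(invlog has_derivative (*) (invlog' (h x))) (at (h x))"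
      using invlog_has_derivative[of "h x"] hV[OF x(1)] by (simp add: has_field_derivative_def)
    then have "invlog differentiable (at (h x))" by (auto simp: differentiable_def)
    moreover have "h differentiable (at x)"
      unfolding h_def by (rule norm_squares_differentiable[OF F(2) _ F(1)]) (use x V(4) in auto)
    ultimately show ?thesis
      using differentiable_chain_at[of h x invlog] by (simp add: u_def o_def)
  qed
  \<comment> \<open>The weak gradient exists on all of \<open>V\<close>, so \<open>V\<close> itself
    serves as the neighbourhood required at each singular point.\<close>
  obtain G where "has_weak_gradient u G V" using W12 by (auto simp: W12_loc_def)
  then have "removable_gradient_singularities V u = A \<inter> V"
    using nd df V(1) by (auto simp: removable_gradient_singularities_def)
  then show ?thesis
    using V(1,2) uc W12 nd df by blast
qed

end
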